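(* (Spectral Decomposition for $\mathcal H^n$.) Let $\mathbb F$ be a field of characteristic $p>n$ or $p=0$, let $n\ge2$ and $0\le k\le n$. Then for every $0\le j\le k$, with $m:=\min\{k-j,n-k\}$: (i) The eigenvalues of $\nu^+_{k,j}:E_{k,j}\to E_{k,j}$ are $\lambda_{k,j,i}:=2(k-j+1-i)(n-k-i)$ for $0\le i\le m$. The $\lambda_{k,j,i}$, $0\le i\le m$, are pairwise distinct, and $\lambda_{k,j,i}=0$ if and only if $i=n-k\le k-j$. (ii) The map $\nu^+_{k,j}:E_{k,j}\to E_{k,j}$ is semi-simple. For $0\le i\le m$ let $E_{k,j,i}\subseteq E_{k,j}$ be the eigenspace for $\lambda_{k,j,i}$. Then $\dim E_{k,j,i}=d_{j+i,j}-d_{j+i-1,j}$. (iii) For every $0\le i\le n-j$ the maps $\epsilon$ and $\partial$ restrict to isomorphisms $$E_{j+i,j,i}\longleftrightarrow E_{j+i+1,j,i}\longleftrightarrow\cdots\longleftrightarrow E_{n-i,j,i}$$ (that is, $\epsilon:E_{s,j,i}\to E_{s+1,j,i}$ and $\partial:E_{s+1,j,i}\to E_{s,j,i}$ are isomorphisms for $j+i\le s<n-i$), while $\partial(E_{j+i,j,i})=0=\epsilon(E_{n-i,j,i})$.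
   Context: Let $V=\{\alpha_1,\bar\alpha_1,\dots,\alpha_n,\bar\alpha_n\}$ be a set of $2n$ distinct elements, with $\bar{\bar\alpha}_i=\alpha_i$. For $0\le k\le n$, $L^n_k$ is the set of $k$-element subsets $x\subseteq V$ with $|x\cap\{\alpha_i,\bar\alpha_i\}|\le1$ for all $i$; $M^n_k$ is the $\mathbb F$-vector space with basis $L^n_k$ ($M^n_k=0$ if $k<0$ or $k>n$), $M^n=\bigoplus_kM^n_k$. Elements are written as polynomials in the vertices: a product of distinct vertices forming such a set denotes that set, extended bilinearly. Linear maps $\epsilon,\partial:M^n\to M^n$ are given on $x\in L^n_k$ by $\epsilon(x)=\sum_{y\in L^n_{k+1},\,y\supset x}y$, $\partial(x)=\sum_{z\in L^n_{k-1},\,z\subset x}z$; $\epsilon_k,\partial_k$ are their restrictions to $M^n_k$, and $\nu^+_k=\partial_{k+1}\epsilon_k$. Let $\dot V=\{\alpha_1,\dots,\alpha_n\}$; for disjoint $a,b\subseteq\dot V$, $[a,b]=\prod_{\alpha\in a}(\alpha+\bar\alpha)\prod_{\beta\in b}(\beta-\bar\beta)$, $[\emptyset,\emptyset]=\emptyset$. $E_{k,j}$ is the span of all $[a,b]$ with $a,b\subseteq\dot V$ disjoint, $|a|=k-j$, $|b|=j$; $\epsilon,\partial$ map $E_{k,j}$ into $E_{k+1,j}$, $E_{k-1,j}$, and $\nu^+_{k,j}:E_{k,j}\to E_{k,j}$ is the restriction of $\nu^+_k$. In general $E_{s,j,i}$ denotes the eigenspace of $\nu^+_{s,j}$ for the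 eigenvalue $2(s-j+1-i)(n-s-i)$. $d_{k,j}:=\binom nk\binom kj$ for $0\le j\le k\le n$ and $d_{k,j}=0$ if $k<j$ or $n<k$. *)

theory Defs
  imports
    "HOL-Library.Multiset"
    "HOL-Library.Poly_Mapping"
    "HOL-Computational_Algebra.Computational_Algebra"
begin

datatype vertex = Alpha nat | Abar nat

primrec bar :: "vertex \<Rightarrow> vertex" where
  "bar (Alpha i) = Abar i"
| "bar (Abar i) = Alpha i"

definition Vdot :: "nat \<Rightarrow> vertex set" where
  "Vdot n = Alpha ` {1..n}"

definition V :: "nat \<Rightarrow> vertex set" where
  "V n = Vdot n \<union> bar ` Vdot n"

definition L :: "nat \<Rightarrow> nat \<Rightarrow> vertex set set" where
  "L n k = {x. x \<subseteq> V n \<and> card x = k \<and> (\<forall>\<alpha>\<in>Vdot n. card (x \<inter> {\<alpha>, bar \<alpha>}) \<le> 1)}"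

text \<open>
  Polynomials over \<open>'f\<close> in commuting vertices; a monomial is the multiset of its factors.
  A set \<open>x\<close> of vertices is identified with the squarefree monomial \<open>\<Prod>v\<in>x. v\<close>, so that
  \<open>M\<^sup>n\<^sub>k\<close>, the vector space with basis \<open>L n k\<close>, is the span of these monomials.
\<close>
type_synonym 'f vpoly = "vertex multiset \<Rightarrow>\<^sub>0 'f"

definition smul :: "'f::field \<Rightarrow> 'f vpoly \<Rightarrow> 'f vpoly" where
  "smul c p = Poly_Mapping.single {#} c * p"

interpretation vp: vector_space "smul :: 'f::field \<Rightarrow> 'f vpoly \<Rightarrow> 'f vpoly"
  by unfold_locales
    (simp_all add: smul_def distrib_left distrib_right mult_single single_add
      flip: mult.assoc)

definition face :: "vertex set \<Rightarrow> 'f::field vpoly" where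
  "face x = Poly_Mapping.single (mset_set x) 1"

definition var :: "vertex \<Rightarrow> 'f::field vpoly" where
  "var v = face {v}"

definition M :: "nat \<Rightarrow> nat \<Rightarrow> 'f::field vpoly set" where
  "M n k = vp.span (face ` L n k)"

text \<open>
  \<open>lin_ext n g\<close> extends \<open>g\<close> linearly from the basis of \<open>M\<^sup>n\<close>; the monomials outside this
  basis are sent to 0, and the maps below only ever matter on \<open>M\<^sup>n\<close>.
\<close>
definition lin_ext :: "nat \<Rightarrow> (vertex set \<Rightarrow> 'f vpoly) \<Rightarrow> 'f vpoly \<Rightarrow> 'f::field vpoly" where
  "lin_ext n g p = (\<Sum>x\<in>(\<Union>k\<le>n. L n k). smul (Poly_Mapping.lookup p (mset_set x)) (g x))"

definition eps :: "nat \<Rightarrow> 'f vpoly \<Rightarrow> 'f::field vpoly" where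
  "eps n = lin_ext n (\<lambda>x. \<Sum>y | y \<in> L n (card x + 1) \<and> x \<subset> y. face y)"

definition bd :: "nat \<Rightarrow> 'f vpoly \<Rightarrow> 'f::field vpoly" where
  "bd n = lin_ext n (\<lambda>x. \<Sum>z | z \<in> L n (card x - 1) \<and> z \<subset> x. face z)"

definition nu_plus :: "nat \<Rightarrow> 'f vpoly \<Rightarrow> 'f::field vpoly" where
  "nu_plus n = bd n \<circ> eps n"

definition bracket :: "vertex set \<Rightarrow> vertex set \<Rightarrow> 'f::field vpoly" where
  "bracket a b = (\<Prod>\<alpha>\<in>a. var \<alpha> + var (bar \<alpha>)) * (\<Prod>\<beta>\<in>b. var \<beta> - var (bar \<beta>))"

text \<open>The condition \<open>|a| = k - j\<close> is stated without truncated subtraction.\<close>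
definition E :: "nat \<Rightarrow> nat \<Rightarrow> nat \<Rightarrow> 'f::field vpoly set" where
  "E n k j = vp.span {bracket a b | a b.
     a \<subseteq> Vdot n \<and> b \<subseteq> Vdot n \<and> a \<inter> b = {} \<and> card a + j = k \<and> card b = j}"

definition eigenspace_on ::
    "('f vpoly \<Rightarrow> 'f vpoly) \<Rightarrow> 'f vpoly set \<Rightarrow> 'f::field \<Rightarrow> 'f vpoly set" where
  "eigenspace_on T U c = {v \<in> U. T v = smul c v}"

definition eigenvalues_on ::
    "('f vpoly \<Rightarrow> 'f vpoly) \<Rightarrow> 'f vpoly set \<Rightarrow> 'f::field set" where
  "eigenvalues_on T U = {c. \<exists>v\<in>U. v \<noteq> 0 \<and> T v = smul c v}"

definition invariant_subspace ::
    "('f vpoly \<Rightarrow> 'f vpoly) \<Rightarrow> 'f::field vpoly set \<Rightarrow> bool" where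
  "invariant_subspace T W \<longleftrightarrow> vp.subspace W \<and> T ` W \<subseteq> W"

text \<open>
  \<open>T\<close> restricts to a semisimple endomorphism of the subspace \<open>U\<close>: every invariant subspace of
  \<open>U\<close> has an invariant complement in \<open>U\<close>.
\<close>
definition semisimple_on ::
    "('f vpoly \<Rightarrow> 'f vpoly) \<Rightarrow> 'f::field vpoly set \<Rightarrow> bool" where
  "semisimple_on T U \<longleftrightarrow> invariant_subspace T U \<and>
     (\<forall>W. W \<subseteq> U \<and> invariant_subspace T W \<longrightarrow>
       (\<exists>W'. W' \<subseteq> U \<and> invariant_subspace T W' \<and> W \<inter> W' = {0} \<and>
         {w + w' | w w'. w \<in> W \<and> w' \<in> W'} = U))"

definition restricts_to_iso ::
    "('f vpoly \<Rightarrow> 'f vpoly) \<Rightarrow> 'f::field vpoly set \<Rightarrow> 'f vpoly set \<Rightarrow> bool" where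
  "restricts_to_iso T U W \<longleftrightarrow> vp.subspace U \<and> vp.subspace W \<and>
     Vector_Spaces.linear smul smul T \<and> bij_betw T U W"

text \<open>Integer arithmetic, since the factors may be negative for general \<open>i\<close>.\<close>
definition lam :: "nat \<Rightarrow> nat \<Rightarrow> nat \<Rightarrow> nat \<Rightarrow> 'f::field" where
  "lam n k j i = of_int (2 * (int k - int j + 1 - int i) * (int n - int k - int i))"

definition Eig :: "nat \<Rightarrow> nat \<Rightarrow> nat \<Rightarrow> nat \<Rightarrow> 'f::field vpoly set" where
  "Eig n k j i = eigenspace_on (nu_plus n) (E n k j) (lam n k j i)"

text \<open>The first index is an integer because \<open>k = j + i - 1 = -1\<close> occurs.\<close>
definition d :: "nat \<Rightarrow> int \<Rightarrow> nat \<Rightarrow> int" where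
  "d n k j = (if int j \<le> k \<and> k \<le> int n
     then int ((n choose nat k) * (nat k choose j)) else 0)"

end

theory Submission
  imports Defs
begin

text \<open>
  Fix \<open>j\<close> and put \<open>N = n - j\<close>, \<open>U\<^sub>t = E\<^bsub>j+t,j\<^esub>\<close>. On brackets \<open>\<epsilon>\<close> adds an element to the first
  entry and \<open>\<partial>\<close> removes one, with a factor 2, so \<open>\<partial>\<epsilon> - \<epsilon>\<partial> = 2(N - 2t)\<close> on \<open>U\<^sub>t\<close>. Hence \<open>\<epsilon>\<close> and \<open>\<partial>\<close>
  intertwine \<open>\<partial>\<epsilon> - \<lambda>\<^sub>t\<^sub>,\<^sub>i\<close> and \<open>\<partial>\<epsilon> - \<lambda>\<^bsub>t+1,i\<^esub>\<close>, where \<open>\<lambda>\<^sub>t\<^sub>,\<^sub>i = 2(t+1-i)(N-t-i)\<close>. Climbing up from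
  \<open>t = 0\<close> shows that the product of \<open>\<partial>\<epsilon> - \<lambda>\<^sub>t\<^sub>,\<^sub>i\<close> over \<open>i \<le> t\<close> vanishes on \<open>U\<^sub>t\<close>; climbing down from
  \<open>t = N\<close> shows the same for \<open>i \<le> N - t\<close>. Under the hypothesis on the characteristic the shorter of the
  two products has distinct roots, so \<open>\<partial>\<epsilon>\<close> is diagonalizable. On eigenspaces \<open>\<partial>\<epsilon>\<close> and \<open>\<epsilon>\<partial>\<close> are
  scalars, which gives the isomorphisms; with them and \<open>dim U\<^sub>t = (n choose j)(N choose t)\<close> the
  eigenspace dimensions follow by summing over \<open>i\<close>.
\<close>

section \<open>Eigenvectors\<close>

lemma linear_smul_algebra:
  fixes T :: "'f::field vpoly \<Rightarrow> 'f vpoly"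
  assumes "Vector_Spaces.linear smul smul T"
  shows "T (x + y) = T x + T y" "T (smul c x) = smul c (T x)" "T 0 = 0"
    "T (x - y) = T x - T y" "T (sum g A) = (\<Sum>a\<in>A. T (g a))"
proof -
  interpret Vector_Spaces.linear smul smul T by fact
  show "T (x + y) = T x + T y" "T (smul c x) = smul c (T x)" "T 0 = 0"
    "T (x - y) = T x - T y" "T (sum g A) = (\<Sum>a\<in>A. T (g a))"
    by (simp_all add: add scale diff sum)
qed

text \<open>The polynomial with roots \<open>c 0\<close>, ..., \<open>c (r - 1)\<close>, evaluated
  at \<open>T\<close>. The factor of largest index acts first, so an induction on \<open>r\<close>
  meets the newest factor directly at \<open>v\<close>.\<close>

primrec shift_prod :: "('f vpoly \<Rightarrow> 'f vpoly) \<Rightarrow> (nat \<Rightarrow> 'f) \<Rightarrow> nat \<Rightarrow> 'f::field vpoly \<Rightarrow> 'f vpoly"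
  where
    "shift_prod T c 0 v = v"
  | "shift_prod T c (Suc r) v = shift_prod T c r (T v - smul (c r) v)"

lemma subspace_eigenspace_on:
  assumes "Vector_Spaces.linear smul smul T" "vp.subspace U"
  shows "vp.subspace (eigenspace_on T U c)"
  using assms(2) unfolding vp.subspace_def eigenspace_on_def
  by (auto simp: linear_smul_algebra[OF assms(1)] vp.scale_right_distrib vp.scale_left_commute)

text \<open>By induction \<open>T v - smul (c r) v\<close> is a sum of vectors \<open>w i\<close>
  from the eigenspaces of the other roots. Dividing each \<open>w i\<close> by the nonzero
  \<open>c i - c r\<close> and summing gives \<open>s\<close> with the same image as
  \<open>v\<close> under \<open>T - c r\<close>, so \<open>v - s\<close> lies in the eigenspace of
  \<open>c r\<close>. Only \<open>v\<close> itself has to be annihilated.\<close>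

lemma eigenvector_decomposition:
  fixes T :: "'f::field vpoly \<Rightarrow> 'f vpoly"
  assumes lin: "Vector_Spaces.linear smul smul T"
    and sub: "vp.subspace U" and inv: "\<And>v. v \<in> U \<Longrightarrow> T v \<in> U"
  shows "v \<in> U \<Longrightarrow> shift_prod T c r v = 0 \<Longrightarrow> inj_on c {..<r} \<Longrightarrow>
    \<exists>w. (\<forall>i<r. w i \<in> eigenspace_on T U (c i)) \<and> v = (\<Sum>i<r. w i)"
proof (induction r arbitrary: v)
  case 0
  then show ?case by simp
next
  case (Suc r)
  note T = linear_smul_algebra[OF lin]
  have "T v - smul (c r) v \<in> U"
    using Suc.prems sub inv by (simp add: vp.subspace_diff vp.subspace_scale)
  moreover have "inj_on c {..<r}"
    using Suc.prems(3) by (rule inj_on_subset) auto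
  ultimately obtain w where w: "\<forall>i<r. w i \<in> eigenspace_on T U (c i)"
      and eq: "T v - smul (c r) v = (\<Sum>i<r. w i)"
    using Suc.IH[of "T v - smul (c r) v"] Suc.prems(2) by auto
  have ne: "c i - c r \<noteq> 0" if "i < r" for i
    using Suc.prems(3) that by (auto simp: inj_on_def)
  define u where "u i = smul (inverse (c i - c r)) (w i)" for i
  have u: "u i \<in> eigenspace_on T U (c i)" if "i < r" for i
    unfolding u_def using w that subspace_eigenspace_on[OF lin sub]
    by (simp add: vp.subspace_scale)
  have Tu: "T (u i) - smul (c r) (u i) = w i" if "i < r" for i
  proof -
    have "T (u i) = smul (c i) (u i)"
      using u[OF that] by (simp add: eigenspace_on_def)
    then have "T (u i) - smul (c r) (u i) = smul (c i - c r) (u i)"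
      by (simp add: vp.scale_left_diff_distrib)
    also have "\<dots> = w i"
      using ne[OF that] by (simp add: u_def)
    finally show ?thesis .
  qed
  define s where "s = (\<Sum>i<r. u i)"
  have sU: "s \<in> U"
    unfolding s_def using u by (intro vp.subspace_sum sub) (auto simp: eigenspace_on_def)
  have "T s - smul (c r) s = (\<Sum>i<r. T (u i) - smul (c r) (u i))"
    by (simp add: s_def T vp.scale_sum_right sum_subtractf)
  also have "\<dots> = T v - smul (c r) v"
    using Tu eq by simp
  finally have "T (v - s) = smul (c r) (v - s)"
    by (simp add: T vp.scale_right_diff_distrib algebra_simps)
  then have "v - s \<in> eigenspace_on T U (c r)"
    using Suc.prems(1) sU sub by (simp add: eigenspace_on_def vp.subspace_diff)
  then show ?case
    using u by (intro exI[of _ "u(r := v - s)"]) (auto simp: s_def less_Suc_eq)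
qed

text \<open>Applying \<open>T - c k\<close> to the vanishing sum removes the term of index
  \<open>k\<close> and multiplies the others by \<open>c i - c k\<close>, which is nonzero by
  injectivity; the induction hypothesis is then used for the rescaled vectors.\<close>

lemma eigenvectors_sum_zero:
  fixes T :: "'f::field vpoly \<Rightarrow> 'f vpoly"
  assumes lin: "Vector_Spaces.linear smul smul T"
  shows "finite I \<Longrightarrow> inj_on c I \<Longrightarrow> (\<And>i. i \<in> I \<Longrightarrow> T (w i) = smul (c i) (w i)) \<Longrightarrow>
    (\<Sum>i\<in>I. w i) = 0 \<Longrightarrow> i \<in> I \<Longrightarrow> w i = 0"
proof (induction I arbitrary: w i rule: finite_induct)
  case empty
  then show ?case by simp
next
  case (insert k I)
  note T = linear_smul_algebra[OF lin]
  let ?u = "\<lambda>i. smul (c i - c k) (w i)"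
  have "(\<Sum>i\<in>insert k I. T (w i)) = 0"
    by (metis T(3,5) insert.prems(3))
  have "(\<Sum>i\<in>I. ?u i) = (\<Sum>i\<in>insert k I. ?u i)"
    using insert.hyps by simp
  also have "\<dots> = (\<Sum>i\<in>insert k I. T (w i)) - smul (c k) (\<Sum>i\<in>insert k I. w i)"
    by (simp add: insert.prems(2) vp.scale_left_diff_distrib vp.scale_sum_right sum_subtractf
        del: sum.insert)
  also have "\<dots> = 0"
    unfolding \<open>(\<Sum>i\<in>insert k I. T (w i)) = 0\<close> insert.prems(3) by simp
  finally have sum0: "(\<Sum>i\<in>I. ?u i) = 0" .
  have "?u i = 0" if "i \<in> I" for i
  proof (rule insert.IH[of ?u])
    show "inj_on c I"
      using insert.prems(1) by auto
    show "T (?u i) = smul (c i) (?u i)" if "i \<in> I" for i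
      using that by (simp add: insert.prems(2) T vp.scale_left_commute)
  qed (use sum0 that in auto)
  moreover have "c i - c k \<noteq> 0" if "i \<in> I" for i
    using insert.prems(1) insert.hyps that by (auto simp: inj_on_def)
  ultimately have I0: "w i = 0" if "i \<in> I" for i
    using that by auto
  with insert.prems(3) insert.hyps have "w k = 0"
    by simp
  with I0 insert.prems(4) show ?case by auto
qed

text \<open>The annihilating product also kills every invariant subspace \<open>W\<close>, so
  \<open>W\<close> is spanned by eigenvectors. A basis of \<open>W\<close> made of eigenvectors
  extends to such a basis of \<open>U\<close>, and the added vectors span an invariant
  complement.\<close>

lemma semisimple_onI:
  fixes T :: "'f::field vpoly \<Rightarrow> 'f vpoly"
  assumes lin: "Vector_Spaces.linear smul smul T"
    and sub: "vp.subspace U" and inv: "\<And>v. v \<in> U \<Longrightarrow> T v \<in> U"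
    and zero: "\<And>v. v \<in> U \<Longrightarrow> shift_prod T c r v = 0" and inj: "inj_on c {..<r}"
  shows "semisimple_on T U"
proof -
  note T = linear_smul_algebra[OF lin]
  \<comment> \<open>\<open>S\<close> collects the eigenvectors for all eigenvalues, together with 0;
    the span of any subset of it is invariant.\<close>
  define S where "S = {v. \<exists>a. T v = smul a v}"
  have spanned: "W \<subseteq> vp.span (W \<inter> S)"
    if "W \<subseteq> U" "vp.subspace W" "T ` W \<subseteq> W" for W
  proof
    fix v assume v: "v \<in> W"
    have "\<exists>w. (\<forall>i<r. w i \<in> eigenspace_on T W (c i)) \<and> v = (\<Sum>i<r. w i)"
      using v that zero inj by (intro eigenvector_decomposition[OF lin]) auto
    then obtain w where "\<forall>i<r. w i \<in> eigenspace_on T W (c i)" "v = (\<Sum>i<r. w i)"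
      by blast
    then show "v \<in> vp.span (W \<inter> S)"
      by (auto simp only: eigenspace_on_def S_def mem_Collect_eq lessThan_iff Int_iff
          intro!: vp.span_sum intro: vp.span_base)
  qed
  have inv_span: "invariant_subspace T (vp.span B)" if "B \<subseteq> S" for B
  proof -
    have "T v \<in> vp.span B" if "v \<in> vp.span B" for v
      using that
    proof (induction rule: vp.span_induct_alt)
      case base
      then show ?case by (simp add: T vp.span_zero)
    next
      case (step a x y)
      then obtain b where "T x = smul b x"
        using \<open>B \<subseteq> S\<close> by (auto simp: S_def)
      with step show ?case
        by (simp add: T vp.span_add vp.span_scale vp.span_base)
    qed
    then show ?thesis
      by (auto simp: invariant_subspace_def)
  qed
  show ?thesis
    unfolding semisimple_on_def
  proof (intro conjI allI impI)
    show "invariant_subspace T U"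
      using sub inv by (auto simp: invariant_subspace_def)
    fix W assume W: "W \<subseteq> U \<and> invariant_subspace T W"
    obtain A where A: "A \<subseteq> W \<inter> S" "vp.independent A" "W \<inter> S \<subseteq> vp.span A"
      using vp.maximal_independent_subset by blast
    obtain B where B: "A \<subseteq> B" "B \<subseteq> U \<inter> S" "vp.independent B" "U \<inter> S \<subseteq> vp.span B"
      using vp.maximal_independent_subset_extend[of A "U \<inter> S"] A W by blast
    have WA: "W = vp.span A"
    proof
      show "W \<subseteq> vp.span A"
        using spanned[of W] W A(3) vp.span_minimal[OF A(3)]
        by (auto simp: invariant_subspace_def)
      show "vp.span A \<subseteq> W"
        using A(1) W by (intro vp.span_minimal) (auto simp: invariant_subspace_def)
    qed
    have UB: "U = vp.span B"
    proof
      show "U \<subseteq> vp.span B"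
        using spanned[of U] sub inv vp.span_minimal[OF B(4)] by auto
      show "vp.span B \<subseteq> U"
        using B(2) sub by (intro vp.span_minimal) auto
    qed
    have "{w + w' | w w'. w \<in> W \<and> w' \<in> vp.span (B - A)} = U"
      unfolding WA UB vp.span_Un[symmetric] using B(1) by (simp add: Un_absorb1)
    moreover have "W \<inter> vp.span (B - A) = {0}"
    proof -
      have "v = 0" if v: "v \<in> vp.span A" "v \<in> vp.span (B - A)" for v
      proof -
        \<comment> \<open>A vector in both spans has its \<open>B\<close>-coordinates supported on
          \<open>A\<close> and on \<open>B - A\<close> at once, so they all vanish.\<close>
        have "vp.representation A v = vp.representation B v"
             "vp.representation (B - A) v = vp.representation B v"
          using v B(1,3) by (auto intro: vp.representation_extend[symmetric])
        then have "vp.representation B v b = 0" for b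
          using vp.representation_ne_zero[of A v b] vp.representation_ne_zero[of "B - A" v b]
          by (metis DiffD2)
        moreover have "v \<in> vp.span B"
          using v(1) B(1) vp.span_mono by blast
        ultimately show "v = 0"
          using vp.sum_nonzero_representation_eq[OF B(3), of v] by simp
      qed
      then show ?thesis
        by (auto simp: WA vp.span_zero)
    qed
    moreover have "vp.span (B - A) \<subseteq> U"
      unfolding UB by (intro vp.span_mono) auto
    moreover have "invariant_subspace T (vp.span (B - A))"
      using B(2) by (intro inv_span) auto
    ultimately show "\<exists>W'\<subseteq>U. invariant_subspace T W' \<and> W \<inter> W' = {0} \<and>
         {w + w' | w w'. w \<in> W \<and> w' \<in> W'} = U"
      by blast
  qed
qed

text \<open>The union of bases \<open>B i\<close> of the eigenspaces is a basis of \<open>U\<close>: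
  \<open>eigenvectors_sum_zero\<close> gives independence, \<open>eigenvector_decomposition\<close>
  gives spanning. The set \<open>F\<close> makes each \<open>B i\<close> finite.\<close>

lemma dim_eigenspaces:
  fixes T :: "'f::field vpoly \<Rightarrow> 'f vpoly"
  assumes lin: "Vector_Spaces.linear smul smul T"
    and sub: "vp.subspace U" and inv: "\<And>v. v \<in> U \<Longrightarrow> T v \<in> U"
    and zero: "\<And>v. v \<in> U \<Longrightarrow> shift_prod T c r v = 0" and inj: "inj_on c {..<r}"
    and fin: "finite F" "U \<subseteq> vp.span F"
  shows "vp.dim U = (\<Sum>i<r. vp.dim (eigenspace_on T U (c i)))"
proof -
  let ?X = "\<lambda>i. eigenspace_on T U (c i)"
  have "\<exists>B. B \<subseteq> ?X i \<and> vp.independent B \<and> ?X i \<subseteq> vp.span B \<and> card B = vp.dim (?X i)" for i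
    by (meson vp.basis_exists)
  then obtain B where B: "B i \<subseteq> ?X i" "vp.independent (B i)" "?X i \<subseteq> vp.span (B i)"
      "card (B i) = vp.dim (?X i)" for i
    by metis
  have XU: "?X i \<subseteq> U" for i
    by (auto simp: eigenspace_on_def)
  have finB: "finite (B i)" for i
    using vp.independent_span_bound[OF fin(1) B(2)] B(1)[of i] XU[of i] fin(2) by blast
  \<comment> \<open>Disjointness lets the cardinalities add up. A common element would belong to two
    distinct roots and hence be 0, which no independent set contains.\<close>
  have disj: "B i \<inter> B j = {}" if "i < r" "j < r" "i \<noteq> j" for i j
  proof -
    have "b = 0" if "b \<in> B i" "b \<in> B j" for b
    proof -
      have "smul (c i) b = smul (c j) b"
        using subsetD[OF B(1) that(1)] subsetD[OF B(1) that(2)] by (simp add: eigenspace_on_def)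
      then show "b = 0"
        using inj \<open>i < r\<close> \<open>j < r\<close> \<open>i \<noteq> j\<close> by (auto simp: inj_on_def)
    qed
    then show ?thesis
      using B(2)[of i] vp.dependent_zero by blast
  qed
  have "vp.independent (\<Union>i<r. B i)"
  proof (rule vp.independent_if_scalars_zero)
    show "finite (\<Union>i<r. B i)"
      using finB by simp
    fix g b assume 0: "(\<Sum>b\<in>(\<Union>i<r. B i). smul (g b) b) = 0" and b: "b \<in> (\<Union>i<r. B i)"
    then obtain i where i: "i < r" "b \<in> B i" by auto
    let ?x = "\<lambda>i. \<Sum>b\<in>B i. smul (g b) b"
    have "(\<Sum>i<r. ?x i) = 0"
      using 0 disj finB by (subst (asm) sum.UNION_disjoint) auto
    moreover have "T (?x i) = smul (c i) (?x i)" for i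
    proof -
      have "?x i \<in> ?X i"
        using B(1) subspace_eigenspace_on[OF lin sub]
        by (intro vp.subspace_sum vp.subspace_scale) auto
      then show ?thesis
        by (simp add: eigenspace_on_def)
    qed
    ultimately have "?x i = 0"
      using i(1) inj by (intro eigenvectors_sum_zero[OF lin, of "{..<r}" c ?x i]) auto
    then show "g b = 0"
      using vp.independentD[OF B(2) finB subset_refl] i(2) by blast
  qed
  moreover have "U \<subseteq> vp.span (\<Union>i<r. B i)"
  proof
    fix v assume v: "v \<in> U"
    have "\<exists>w. (\<forall>i<r. w i \<in> ?X i) \<and> v = (\<Sum>i<r. w i)"
      using v by (intro eigenvector_decomposition[OF lin sub inv] zero inj) auto
    then obtain w where w: "\<forall>i<r. w i \<in> ?X i" "v = (\<Sum>i<r. w i)"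
      by blast
    have "w i \<in> vp.span (\<Union>i<r. B i)" if "i < r" for i
      using w(1) that B(3)[of i] vp.span_mono[of "B i" "\<Union>i<r. B i"] by blast
    then show "v \<in> vp.span (\<Union>i<r. B i)"
      unfolding w(2) by (intro vp.span_sum) auto
  qed
  moreover have "(\<Union>i<r. B i) \<subseteq> U"
    using B(1) XU by blast
  ultimately have "vp.dim U = card (\<Union>i<r. B i)"
    using vp.basis_card_eq_dim by metis
  also have "\<dots> = (\<Sum>i<r. card (B i))"
    using disj finB by (intro card_UN_disjoint) auto
  finally show ?thesis
    by (simp add: B(4))
qed

lemma dim_restricts_to_iso:
  fixes T :: "'f::field vpoly \<Rightarrow> 'f vpoly"
  assumes "restricts_to_iso T U W"
  shows "vp.dim U = vp.dim W"
proof -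
  interpret T: Vector_Spaces.linear smul smul T
    using assms by (simp add: restricts_to_iso_def)
  have U: "vp.span U = U" and bij: "bij_betw T U W"
    using assms by (auto simp: restricts_to_iso_def vp.span_eq_iff)
  obtain B where B: "B \<subseteq> U" "vp.independent B" "U \<subseteq> vp.span B" "card B = vp.dim U"
    using vp.basis_exists by blast
  have sB: "vp.span B = U"
    using B U vp.span_mono by blast
  have inj: "inj_on T U" and im: "T ` U = W"
    using bij by (auto simp: bij_betw_def)
  have "vp.independent (T ` B)"
    using B(2) inj sB by (intro T.independent_injective_image) auto
  moreover have "T ` B \<subseteq> W" "W \<subseteq> vp.span (T ` B)"
    using B(1) im sB T.span_image[of B] by auto
  ultimately have "card (T ` B) = vp.dim W"
    by (intro vp.basis_card_eq_dim)
  moreover have "card (T ` B) = card B"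
    using inj B(1) by (intro card_image) (auto intro: inj_on_subset)
  ultimately show ?thesis
    using B(4) by simp
qed

section \<open>Raising and lowering operators\<close>

text \<open>Up to scaling these are the relations of sl_2, with \<open>U t\<close> in weight N - 2t.
  The intended instance is \<open>U t = E n (j + t) j\<close>, \<open>N = n - j\<close>,
  \<open>K = n choose j\<close>; the spectral argument can then proceed without brackets.\<close>

locale raising_lowering =
  fixes e D :: "'f::field vpoly \<Rightarrow> 'f vpoly" and U :: "nat \<Rightarrow> 'f vpoly set" and N K :: nat
  assumes linear_e: "Vector_Spaces.linear smul smul e"
    and linear_D: "Vector_Spaces.linear smul smul D"
    and subspace_U: "vp.subspace (U t)"
    and e_in: "v \<in> U t \<Longrightarrow> e v \<in> U (Suc t)"
    and D_in: "v \<in> U (Suc t) \<Longrightarrow> D v \<in> U t"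
    and D_bottom: "v \<in> U 0 \<Longrightarrow> D v = 0"
    and e_top: "v \<in> U N \<Longrightarrow> e v = 0"
    and commutator: "v \<in> U t \<Longrightarrow> t \<le> N \<Longrightarrow>
      D (e v) = e (D v) + smul (of_int (2 * (int N - 2 * int t))) v"
    and two_neq_0: "(2 :: 'f) \<noteq> 0"
    and of_nat_neq_0: "0 < a \<Longrightarrow> a \<le> N \<Longrightarrow> (of_nat a :: 'f) \<noteq> 0"
    and K_pos: "0 < K"
    and dim_U: "t \<le> N \<Longrightarrow> vp.dim (U t) = K * (N choose t)"
    and finite_span_U: "\<exists>F. finite F \<and> U t \<subseteq> vp.span F"
begin

text \<open>For \<open>i \<le> t\<close> this is the sum of the commutator scalars 2(N - 2s) for s
  from \<open>i\<close> to \<open>t\<close>: the scalar by which \<open>D \<circ> e\<close> acts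
  after a vector of layer \<open>i\<close> killed by \<open>D\<close> has been raised to layer
  \<open>t\<close>. It is \<open>lam\<close> rewritten for \<open>k = j + t\<close>,
  \<open>n = j + N\<close>.\<close>

definition eigval :: "nat \<Rightarrow> nat \<Rightarrow> 'f" where
  "eigval t i = of_int (2 * (int t + 1 - int i) * (int N - int t - int i))"

definition eigsp :: "nat \<Rightarrow> nat \<Rightarrow> 'f vpoly set" where
  "eigsp t i = eigenspace_on (D \<circ> e) (U t) (eigval t i)"

lemmas e_simps = linear_smul_algebra[OF linear_e]
lemmas D_simps = linear_smul_algebra[OF linear_D]

lemma linear_De: "Vector_Spaces.linear smul smul (D \<circ> e)"
  using linear_e linear_D by (rule Vector_Spaces.linear_compose)

lemma De_in: "v \<in> U t \<Longrightarrow> (D \<circ> e) v \<in> U t"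
  by (simp add: D_in e_in)

section \<open>Arithmetic of the eigenvalues in the field\<close>

lemma of_int_neq_0:
  assumes "a \<noteq> 0" "\<bar>a\<bar> \<le> int N"
  shows "(of_int a :: 'f) \<noteq> 0"
proof -
  have "(of_nat (nat \<bar>a\<bar>) :: 'f) \<noteq> 0"
    using assms by (intro of_nat_neq_0) auto
  then show ?thesis
    by (cases "a \<ge> 0") (auto simp: of_nat_nat)
qed

lemma eigval_Suc: "eigval (Suc t) i = eigval t i + of_int (2 * (int N - 2 * int (Suc t)))"
  unfolding eigval_def of_int_add[symmetric] by (simp add: algebra_simps)

text \<open>The difference of the two values is 2(i - i')(i + i' - N - 1). The bounds on
  \<open>i + i'\<close> put the last factor between -N and N, and excluding \<open>N + 1\<close>
  keeps it away from 0; \<open>N + 1\<close> is the centre of the symmetry sending i to N + 1 -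
  i.\<close>

lemma eigval_eq_iff:
  assumes "i \<le> N" "i' \<le> N" "0 < i + i'" "i + i' < 2 * N + 1" "i + i' \<noteq> N + 1"
  shows "eigval t i = eigval t i' \<longleftrightarrow> i = i'"
proof
  assume "eigval t i = eigval t i'"
  then have "(2 :: 'f) * of_int ((int i - int i') * (int i + int i' - int N - 1)) = 0"
    unfolding eigval_def eq_iff_diff_eq_0[of "of_int _"] of_int_diff[symmetric]
    by (simp add: algebra_simps)
  then have "of_int (int i - int i') = (0::'f) \<or> of_int (int i + int i' - int N - 1) = (0::'f)"
    using two_neq_0 by (simp only: of_int_mult mult_eq_0_iff) blast
  moreover have "of_int (int i + int i' - int N - 1) \<noteq> (0::'f)"
    using assms by (intro of_int_neq_0) auto
  ultimately have "of_int (int i - int i') = (0::'f)"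
    by blast
  then show "i = i'"
    using of_int_neq_0[of "int i - int i'"] assms(1,2) by force
qed auto

lemma inj_on_eigval: "t \<le> N \<Longrightarrow> inj_on (eigval t) {..<Suc (min t (N - t))}"
proof (rule inj_onI)
  fix i i' assume "t \<le> N" "i \<in> {..<Suc (min t (N - t))}" "i' \<in> {..<Suc (min t (N - t))}"
    and eq: "eigval t i = eigval t i'"
  then have "i \<le> t" "i \<le> N - t" "i' \<le> t" "i' \<le> N - t" by auto
  then show "i = i'"
    \<comment> \<open>The case \<open>i + i' = 0\<close>, not covered by
      \<open>eigval_eq_iff\<close>, forces both indices to be 0.\<close>
    using eigval_eq_iff[of i i' t] eq \<open>t \<le> N\<close> by (cases "i + i' = 0") auto
qed

lemma eigval_eq_0_iff:
  assumes "t \<le> N" "i \<le> t" "i \<le> N - t"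
  shows "eigval t i = 0 \<longleftrightarrow> i = N - t"
proof
  assume "eigval t i = 0"
  moreover have "int t + 1 - int i = int (t + 1 - i)" "int N - int t - int i = int (N - t - i)"
    using assms by auto
  ultimately have "(2::'f) * of_nat (t + 1 - i) * of_nat (N - t - i) = 0"
    by (simp only: eigval_def of_int_mult of_int_of_nat_eq of_int_numeral)
  moreover have "of_nat (N - t - i) \<noteq> (0::'f)" if "i \<noteq> N - t"
    using that assms by (intro of_nat_neq_0) auto
  \<comment> \<open>For \<open>i \<noteq> N - t\<close> one has \<open>t < N\<close>, so
    \<open>t + 1 - i\<close> is at most \<open>N\<close>. The value \<open>N + 1\<close>, which
    might vanish in the field, arises only for \<open>t = N\<close>, \<open>i = 0\<close>, where
    \<open>i = N - t\<close>.\<close>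
  moreover have "of_nat (t + 1 - i) \<noteq> (0::'f)" if "i \<noteq> N - t"
    using that assms by (intro of_nat_neq_0) auto
  ultimately show "i = N - t"
    using two_neq_0 by (metis mult_eq_0_iff)
next
  assume "i = N - t"
  then show "eigval t i = 0"
    using assms by (simp add: eigval_def of_nat_diff)
qed

section \<open>Intertwining relations and the two annihilating products\<close>

lemma eD_eq: "v \<in> U (Suc t) \<Longrightarrow> Suc t \<le> N \<Longrightarrow>
  e (D v) = (D \<circ> e) v - smul (of_int (2 * (int N - 2 * int (Suc t)))) v"
  using commutator[of v "Suc t"] by simp

text \<open>By \<open>eigval_Suc\<close> the commutator scalar is exactly the difference of the two
  eigenvalues. Hence on layer \<open>Suc t\<close> the operators
  \<open>D \<circ> e - eigval (Suc t) i\<close> and \<open>e \<circ> D - eigval t i\<close> agree,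
  and \<open>e\<close> moves to the front. \<open>shift_D\<close> rests on the same
  identity.\<close>

lemma shift_e:
  assumes "v \<in> U t" "Suc t \<le> N"
  shows "(D \<circ> e) (e v) - smul (eigval (Suc t) i) (e v) = e ((D \<circ> e) v - smul (eigval t i) v)"
proof -
  have "(D \<circ> e) (e v) = e (D (e v)) + smul (of_int (2 * (int N - 2 * int (Suc t)))) (e v)"
    using eD_eq[OF e_in[OF assms(1)] assms(2)] by simp
  then show ?thesis
    by (simp add: e_simps eigval_Suc vp.scale_left_distrib)
qed

lemma shift_D:
  assumes "v \<in> U (Suc t)" "Suc t \<le> N"
  shows "(D \<circ> e) (D v) - smul (eigval t i) (D v) = D ((D \<circ> e) v - smul (eigval (Suc t) i) v)"
  using eD_eq[OF assms] by (simp add: D_simps eigval_Suc vp.scale_left_distrib)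

lemma shift_prod_e:
  "v \<in> U t \<Longrightarrow> Suc t \<le> N \<Longrightarrow>
    shift_prod (D \<circ> e) (eigval (Suc t)) r (e v) = e (shift_prod (D \<circ> e) (eigval t) r v)"
proof (induction r arbitrary: v)
  case (Suc r)
  have "(D \<circ> e) v - smul (eigval t r) v \<in> U t"
    using Suc.prems De_in subspace_U by (auto intro!: vp.subspace_diff vp.subspace_scale)
  then show ?case
    using Suc by (simp only: shift_prod.simps shift_e)
qed simp

lemma shift_prod_D:
  "v \<in> U (Suc t) \<Longrightarrow> Suc t \<le> N \<Longrightarrow>
    shift_prod (D \<circ> e) (eigval t) r (D v) = D (shift_prod (D \<circ> e) (eigval (Suc t)) r v)"
proof (induction r arbitrary: v)
  case (Suc r)
  have "(D \<circ> e) v - smul (eigval (Suc t) r) v \<in> U (Suc t)"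
    using Suc.prems De_in subspace_U by (auto intro!: vp.subspace_diff vp.subspace_scale)
  then show ?case
    using Suc by (simp only: shift_prod.simps shift_D)
qed simp

text \<open>\<open>eigval (Suc t) (Suc t)\<close> equals the commutator scalar of layer
  \<open>Suc t\<close>, so the factor applied first is \<open>e \<circ> D\<close>. The remaining
  factors pass through \<open>e\<close> to layer \<open>t\<close>, where the induction hypothesis
  kills \<open>D v\<close>. At layer 0 the relation \<open>D v = 0\<close> leaves the single
  eigenvalue 2N.\<close>

lemma shift_prod_ascending:
  "v \<in> U t \<Longrightarrow> t \<le> N \<Longrightarrow> shift_prod (D \<circ> e) (eigval t) (Suc t) v = 0"
proof (induction t arbitrary: v)
  case 0
  then show ?case
    using commutator[OF 0] D_bottom[of v] by (simp add: e_simps eigval_def)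
next
  case (Suc t)
  have "(D \<circ> e) v - smul (eigval (Suc t) (Suc t)) v = e (D v)"
    using eD_eq[OF Suc.prems] by (simp add: eigval_def algebra_simps)
  then have "shift_prod (D \<circ> e) (eigval (Suc t)) (Suc (Suc t)) v =
      shift_prod (D \<circ> e) (eigval (Suc t)) (Suc t) (e (D v))"
    by (simp only: shift_prod.simps(2)[of _ _ "Suc t"])
  also have "\<dots> = e (shift_prod (D \<circ> e) (eigval t) (Suc t) (D v))"
    using Suc.prems D_in by (intro shift_prod_e) auto
  also have "\<dots> = 0"
    using Suc D_in by (simp only: Suc.IH e_simps Suc_leD)
  finally show ?case .
qed

text \<open>\<open>eigval t (N - t)\<close> is 0, so the factor applied first is
  \<open>D \<circ> e\<close> itself. The remaining factors pass through \<open>D\<close> to the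
  layer above; the induction starts at layer \<open>N\<close>, where \<open>e\<close>
  vanishes.\<close>

lemma shift_prod_descending:
  "v \<in> U (N - s) \<Longrightarrow> s \<le> N \<Longrightarrow> shift_prod (D \<circ> e) (eigval (N - s)) (Suc s) v = 0"
proof (induction s arbitrary: v)
  case 0
  then show ?case
    using e_top[of v] by (simp add: D_simps eigval_def)
next
  case (Suc s)
  let ?t = "N - Suc s"
  have t: "Suc ?t = N - s"
    using Suc.prems by simp
  have "(D \<circ> e) v - smul (eigval ?t (Suc s)) v = D (e v)"
    using Suc.prems by (simp add: eigval_def of_nat_diff)
  then have "shift_prod (D \<circ> e) (eigval ?t) (Suc (Suc s)) v =
      shift_prod (D \<circ> e) (eigval ?t) (Suc s) (D (e v))"
    by (simp only: shift_prod.simps(2)[of _ _ "Suc s"])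
  also have "\<dots> = D (shift_prod (D \<circ> e) (eigval (Suc ?t)) (Suc s) (e v))"
    using Suc.prems e_in by (intro shift_prod_D) auto
  also have "\<dots> = D 0"
    using Suc e_in[OF Suc.prems(1)] by (simp only: t Suc.IH Suc_leD)
  finally show ?case
    by (simp only: D_simps)
qed

text \<open>The shorter of the two products is chosen because its roots are distinct by
  \<open>inj_on_eigval\<close>; the longer one can repeat roots through the symmetry sending i to N
  + 1 - i.\<close>

lemma shift_prod_U:
  assumes "v \<in> U t" "t \<le> N"
  shows "shift_prod (D \<circ> e) (eigval t) (Suc (min t (N - t))) v = 0"
proof (cases "t \<le> N - t")
  case True
  then show ?thesis
    using shift_prod_ascending[OF assms] by (simp only: min.absorb1)
next
  case False
  have "N - (N - t) = t"
    using assms(2) by simp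
  then have "shift_prod (D \<circ> e) (eigval t) (Suc (N - t)) v = 0"
    using shift_prod_descending[of v "N - t"] assms by (metis diff_le_self)
  then show ?thesis
    using False by (simp only: min.absorb2 nle_le)
qed

section \<open>Eigenspaces and the maps between neighbouring layers\<close>

lemma subspace_eigsp: "vp.subspace (eigsp t i)"
  unfolding eigsp_def by (intro subspace_eigenspace_on linear_De subspace_U)

text \<open>On an eigenvector for \<open>c\<close> the annihilating product acts as multiplication
  by the product of the \<open>c - eigval t i\<close>, which is nonzero unless \<open>c\<close> is
  one of the roots.\<close>

lemma eigenvalue_cases:
  assumes "v \<in> U t" "t \<le> N" "(D \<circ> e) v = smul c v" "v \<noteq> 0"
  shows "\<exists>i\<le>min t (N - t). c = eigval t i"
proof (rule ccontr)
  assume "\<not> ?thesis"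
  then have ne: "c - eigval t i \<noteq> 0" if "i < Suc (min t (N - t))" for i
    using that by (metis eq_iff_diff_eq_0 less_Suc_eq_le)
  have "shift_prod (D \<circ> e) (eigval t) r w \<noteq> 0"
    if "(D \<circ> e) w = smul c w" "w \<noteq> 0" "r \<le> Suc (min t (N - t))" for r w
    using that
  proof (induction r arbitrary: w)
    case (Suc r)
    have eq: "(D \<circ> e) w - smul (eigval t r) w = smul (c - eigval t r) w"
      by (simp only: Suc.prems(1) vp.scale_left_diff_distrib)
    have "smul (c - eigval t r) w \<noteq> 0"
      using ne[of r] Suc.prems by auto
    moreover have "(D \<circ> e) (smul (c - eigval t r) w) = smul c (smul (c - eigval t r) w)"
      by (simp only: linear_smul_algebra(2)[OF linear_De] Suc.prems(1) vp.scale_left_commute)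
    ultimately show ?case
      unfolding shift_prod.simps eq using Suc.prems(3) by (intro Suc.IH) auto
  qed simp
  then show False
    using shift_prod_U[OF assms(1,2)] assms(3,4) by blast
qed

text \<open>An index beyond the range could still name a true eigenvalue through the symmetry
  sending i to N + 1 - i. The last hypothesis keeps \<open>i + i'\<close> below \<open>N + 1\<close>
  for every admissible \<open>i'\<close>, which rules this out.\<close>

lemma eigsp_eq_0:
  assumes "t \<le> N" "min t (N - t) < i" "i + min t (N - t) < N + 1"
  shows "eigsp t i = {0}"
proof -
  have "v = 0" if v: "v \<in> eigsp t i" for v
  proof (rule ccontr)
    assume "v \<noteq> 0"
    then obtain i' where "i' \<le> min t (N - t)" "eigval t i = eigval t i'"
      using eigenvalue_cases[of v t "eigval t i"] v assms(1)
      by (auto simp: eigsp_def eigenspace_on_def)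
    then show False
      using eigval_eq_iff[of i i' t] assms(2,3) by linarith
  qed
  then show ?thesis
    using subspace_eigsp vp.subspace_0 by blast
qed

lemma e_eigsp: "v \<in> eigsp t i \<Longrightarrow> Suc t \<le> N \<Longrightarrow> e v \<in> eigsp (Suc t) i"
  using shift_e[of v t i] e_in[of v t] by (simp add: eigsp_def eigenspace_on_def e_simps)

lemma D_eigsp: "v \<in> eigsp (Suc t) i \<Longrightarrow> Suc t \<le> N \<Longrightarrow> D v \<in> eigsp t i"
  using shift_D[of v t i] D_in[of v t] by (simp add: eigsp_def eigenspace_on_def D_simps)

lemma eD_eigsp: "v \<in> eigsp (Suc t) i \<Longrightarrow> Suc t \<le> N \<Longrightarrow> e (D v) = smul (eigval t i) v"
  using eD_eq[of v t] by (simp add: eigsp_def eigenspace_on_def eigval_Suc vp.scale_left_distrib)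

lemma De_eigsp: "v \<in> eigsp t i \<Longrightarrow> D (e v) = smul (eigval t i) v"
  by (simp add: eigsp_def eigenspace_on_def)

text \<open>Both \<open>D \<circ> e\<close> on the lower and \<open>e \<circ> D\<close> on the upper
  eigenspace are multiplication by \<open>eigval t i\<close>, nonzero since
  \<open>i < N - t\<close>. So each map is inverse to the other up to this scalar.\<close>

lemma iso_eigsp:
  assumes "i \<le> t" "t < N - i"
  shows "restricts_to_iso e (eigsp t i) (eigsp (Suc t) i)"
    and "restricts_to_iso D (eigsp (Suc t) i) (eigsp t i)"
proof -
  have N: "Suc t \<le> N" using assms by simp
  let ?c = "inverse (eigval t i)"
  have ne: "eigval t i \<noteq> 0"
    using eigval_eq_0_iff[of t i] assms by simp
  have scaled: "smul ?c (e v) \<in> eigsp (Suc t) i" if "v \<in> eigsp t i" for v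
    using that by (intro vp.subspace_scale subspace_eigsp e_eigsp N)
  have scaled': "smul ?c (D v) \<in> eigsp t i" if "v \<in> eigsp (Suc t) i" for v
    using that by (intro vp.subspace_scale subspace_eigsp D_eigsp N)
  have "bij_betw e (eigsp t i) (eigsp (Suc t) i)"
    by (rule bij_betw_byWitness[where f' = "\<lambda>v. smul ?c (D v)"])
      (auto simp: e_simps De_eigsp eD_eigsp N ne e_eigsp scaled')
  moreover have "bij_betw D (eigsp (Suc t) i) (eigsp t i)"
    by (rule bij_betw_byWitness[where f' = "\<lambda>v. smul ?c (e v)"])
      (auto simp: D_simps De_eigsp eD_eigsp N ne D_eigsp scaled)
  ultimately show "restricts_to_iso e (eigsp t i) (eigsp (Suc t) i)"
    and "restricts_to_iso D (eigsp (Suc t) i) (eigsp t i)"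
    by (simp_all add: restricts_to_iso_def subspace_eigsp linear_e linear_D)
qed

text \<open>If \<open>i \<le> N - i\<close>, then \<open>D\<close> lands in the eigenspace of index
  \<open>i\<close> one layer below, which is trivial because \<open>i\<close> exceeds that layer's
  range (for \<open>i = 0\<close>, \<open>D_bottom\<close> applies). Otherwise
  \<open>eigsp i i\<close> is itself trivial.\<close>

lemma D_eigsp_bottom:
  assumes "i \<le> N"
  shows "D ` eigsp i i = {0}"
proof -
  have "D v = 0" if v: "v \<in> eigsp i i" for v
  proof (cases "i \<le> N - i")
    case True
    show ?thesis
    proof (cases i)
      case 0
      then show ?thesis
        using v D_bottom by (simp add: eigsp_def eigenspace_on_def)
    next
      case (Suc t)
      then have "D v \<in> eigsp t i"
        using v assms by (auto intro: D_eigsp)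
      moreover have "eigsp t i = {0}"
        using Suc True by (intro eigsp_eq_0) auto
      ultimately show ?thesis by simp
    qed
  next
    case False
    then have "eigsp i i = {0}"
      using assms by (intro eigsp_eq_0) auto
    then show ?thesis
      using v D_simps(3) by simp
  qed
  then show ?thesis
    using vp.subspace_0[OF subspace_eigsp] by (auto simp: image_iff)
qed

text \<open>Mirror image of \<open>D_eigsp_bottom\<close>: on layer \<open>N - i + 1\<close> the
  admissible indices end at \<open>i - 1\<close>.\<close>

lemma e_eigsp_top:
  assumes "i \<le> N"
  shows "e ` eigsp (N - i) i = {0}"
proof -
  have "e v = 0" if v: "v \<in> eigsp (N - i) i" for v
  proof (cases "i \<le> N - i")
    case True
    show ?thesis
    proof (cases i)
      case 0
      then show ?thesis
        using v e_top by (simp add: eigsp_def eigenspace_on_def)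
    next
      case (Suc s)
      then have "e v \<in> eigsp (Suc (N - i)) i"
        using v assms by (intro e_eigsp) auto
      moreover have "eigsp (Suc (N - i)) i = {0}"
        using Suc True by (intro eigsp_eq_0) auto
      ultimately show ?thesis by simp
    qed
  next
    case False
    then have "eigsp (N - i) i = {0}"
      using assms by (intro eigsp_eq_0) auto
    then show ?thesis
      using v e_simps(3) by simp
  qed
  then show ?thesis
    using vp.subspace_0[OF subspace_eigsp] by (auto simp: image_iff)
qed

section \<open>Semisimplicity, dimensions and the list of eigenvalues\<close>

lemma semisimple_De: "t \<le> N \<Longrightarrow> semisimple_on (D \<circ> e) (U t)"
  using linear_De subspace_U De_in shift_prod_U inj_on_eigval by (rule semisimple_onI)

lemma dim_eigsp_sum:
  assumes "t \<le> N"
  shows "K * (N choose t) = (\<Sum>i\<le>min t (N - t). vp.dim (eigsp t i))"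
proof -
  obtain F where "finite F" "U t \<subseteq> vp.span F"
    using finite_span_U by blast
  then have "vp.dim (U t) = (\<Sum>i<Suc (min t (N - t)). vp.dim (eigsp t i))"
    unfolding eigsp_def
    using shift_prod_U[OF _ assms] inj_on_eigval[OF assms]
    by (intro dim_eigenspaces[OF linear_De subspace_U]) (auto intro: De_in[unfolded o_def])
  then show ?thesis
    using dim_U[OF assms] by (simp only: lessThan_Suc_atMost)
qed

lemma dim_eigsp_shift:
  "i + r \<le> N - i \<Longrightarrow> vp.dim (eigsp (i + r) i) = vp.dim (eigsp i i)"
proof (induction r)
  case (Suc r)
  then have "restricts_to_iso e (eigsp (i + r) i) (eigsp (Suc (i + r)) i)"
    by (intro iso_eigsp) auto
  then show ?case
    using Suc by (simp add: dim_restricts_to_iso)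
qed simp

text \<open>For \<open>2 * t \<le> N\<close>, moving each eigenspace of layer \<open>t\<close> down
  to its bottom layer gives \<open>K * (N choose t)\<close> as the sum of the bottom dimensions up
  to \<open>t\<close>; consecutive sums are subtracted. The case distinction is needed because
  \<open>i - 1\<close> truncates to 0 at \<open>i = 0\<close>.\<close>

lemma dim_eigsp_bottom:
  assumes "2 * i \<le> N"
  shows "int (vp.dim (eigsp i i)) =
    int K * (int (N choose i) - (if i = 0 then 0 else int (N choose (i - 1))))"
proof -
  have sum: "int K * int (N choose t) = (\<Sum>i\<le>t. int (vp.dim (eigsp i i)))" if "2 * t \<le> N" for t
  proof -
    have "K * (N choose t) = (\<Sum>i\<le>t. vp.dim (eigsp t i))"
      using dim_eigsp_sum[of t] that by (simp add: min_absorb1)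
    also have "\<dots> = (\<Sum>i\<le>t. vp.dim (eigsp i i))"
    proof (rule sum.cong)
      fix i assume "i \<in> {..t}"
      then show "vp.dim (eigsp t i) = vp.dim (eigsp i i)"
        using dim_eigsp_shift[of i "t - i"] that by simp
    qed simp
    finally show ?thesis
      by (metis of_nat_mult of_nat_sum)
  qed
  show ?thesis
  proof (cases i)
    case 0
    then show ?thesis using sum[of 0] by simp
  next
    case (Suc t)
    then show ?thesis
      using sum[of "Suc t"] sum[of t] assms by (simp add: algebra_simps)
  qed
qed

lemma dim_eigsp:
  assumes "i \<le> t" "i \<le> N - t" "t \<le> N"
  shows "int (vp.dim (eigsp t i)) =
    int K * (int (N choose i) - (if i = 0 then 0 else int (N choose (i - 1))))"
  using dim_eigsp_shift[of i "t - i"] dim_eigsp_bottom[of i] assms by simp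

text \<open>The hypotheses give \<open>2 * i \<le> N\<close>, where binomial coefficients still
  increase strictly, so the dimension formula is positive.\<close>

lemma eigsp_nonzero:
  assumes "i \<le> t" "i \<le> N - t" "t \<le> N"
  shows "\<exists>v\<in>eigsp t i. v \<noteq> 0"
proof (rule ccontr)
  assume "\<not> ?thesis"
  then have "eigsp t i = {0}"
    using vp.subspace_0[OF subspace_eigsp] by blast
  then have "vp.dim (eigsp t i) = 0"
    by (intro vp.dim_unique[of "{}"]) (auto simp: vp.independent_empty)
  moreover have "(N choose (i - 1)) < (N choose i)" if "i \<noteq> 0"
    using that assms by (intro binomial_strict_mono) auto
  ultimately show False
    using dim_eigsp[OF assms] K_pos assms by (auto split: if_splits)
qed

lemma eigenvalues_De:
  assumes "t \<le> N"
  shows "eigenvalues_on (D \<circ> e) (U t) = {eigval t i | i. i \<le> min t (N - t)}"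
proof (intro equalityI subsetI)
  fix c assume "c \<in> eigenvalues_on (D \<circ> e) (U t)"
  then show "c \<in> {eigval t i | i. i \<le> min t (N - t)}"
    using eigenvalue_cases[OF _ assms] by (force simp: eigenvalues_on_def)
next
  fix c assume "c \<in> {eigval t i | i. i \<le> min t (N - t)}"
  then obtain i where "c = eigval t i" "i \<le> t" "i \<le> N - t"
    by auto
  then show "c \<in> eigenvalues_on (D \<circ> e) (U t)"
    using eigsp_nonzero[of i t] assms
    by (auto simp: eigenvalues_on_def eigsp_def eigenspace_on_def)
qed

end

section \<open>Transversals and brackets\<close>

text \<open>The unbarred member names the pair; the fibres of \<open>base\<close> over
  \<open>Vdot n\<close> are the pairs {\<alpha>, bar \<alpha>}.\<close>

primrec base :: "vertex \<Rightarrow> vertex" where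
  "base (Alpha i) = Alpha i"
| "base (Abar i) = Alpha i"

text \<open>The choices of exactly one vertex from each pair over \<open>c\<close>, that is, the
  faces with support \<open>c\<close>. Sorting faces by support is what makes \<open>eps\<close> a
  multiplication on each group.\<close>

definition transversals :: "vertex set \<Rightarrow> vertex set set" where
  "transversals c = {x. inj_on base x \<and> base ` x = c}"

lemma finite_Vdot: "finite (Vdot n)" and card_Vdot: "card (Vdot n) = n"
  by (simp_all add: Vdot_def card_image inj_on_def)

lemma base_bar: "base (bar v) = base v"
  by (cases v) simp_all

lemma base_Vdot: "\<alpha> \<in> Vdot n \<Longrightarrow> base \<alpha> = \<alpha>"
  by (auto simp: Vdot_def)

lemma bar_notin_Vdot: "\<alpha> \<in> Vdot n \<Longrightarrow> bar \<alpha> \<notin> Vdot m"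
  by (auto simp: Vdot_def)

lemma bar_eq_iff: "bar u = bar v \<longleftrightarrow> u = v"
  by (cases u; cases v) simp_all

lemma base_eq_iff: "\<alpha> \<in> Vdot n \<Longrightarrow> base v = \<alpha> \<longleftrightarrow> v = \<alpha> \<or> v = bar \<alpha>"
  by (cases v) (auto simp: Vdot_def)

lemma base_vimage: "C \<subseteq> Vdot n \<Longrightarrow> {v. base v \<in> C} = C \<union> bar ` C"
  by (auto simp: base_bar base_Vdot subset_iff) (metis base_eq_iff subsetD subsetI image_eqI)

lemma finite_transversal: "x \<in> transversals c \<Longrightarrow> c \<subseteq> Vdot n \<Longrightarrow> finite x"
  unfolding transversals_def using finite_Vdot finite_imageD finite_subset by blast

text \<open>Meeting every fibre of \<open>base\<close> in at most one vertex is injectivity of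
  \<open>base\<close> on \<open>x\<close>.\<close>

lemma mem_L_iff: "x \<in> L n k \<longleftrightarrow> (\<exists>c\<subseteq>Vdot n. x \<in> transversals c \<and> card c = k)"
proof -
  have sub: "x \<subseteq> V n \<longleftrightarrow> base ` x \<subseteq> Vdot n"
    using base_vimage[of "Vdot n" n] by (auto simp: V_def)
  have inj: "(\<forall>\<alpha>\<in>Vdot n. card (x \<inter> {\<alpha>, bar \<alpha>}) \<le> 1) \<longleftrightarrow> inj_on base x" if "base ` x \<subseteq> Vdot n"
  proof
    assume *: "\<forall>\<alpha>\<in>Vdot n. card (x \<inter> {\<alpha>, bar \<alpha>}) \<le> 1"
    show "inj_on base x"
    proof (rule inj_onI)
      fix u v assume uv: "u \<in> x" "v \<in> x" "base u = base v"
      have \<alpha>: "base u \<in> Vdot n"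
        using uv that by auto
      then have "u \<in> {base u, bar (base u)}" "v \<in> {base u, bar (base u)}"
        using base_eq_iff[OF \<alpha>, of u] base_eq_iff[OF \<alpha>, of v] uv(3) by simp_all
      then show "u = v"
        using bspec[OF * \<alpha>] uv(1,2) card_le_Suc0_iff_eq[of "x \<inter> {base u, bar (base u)}"]
        by (metis IntI One_nat_def finite.emptyI finite_Int finite_insert)
    qed
  next
    assume *: "inj_on base x"
    show "\<forall>\<alpha>\<in>Vdot n. card (x \<inter> {\<alpha>, bar \<alpha>}) \<le> 1"
    proof
      fix \<alpha> assume "\<alpha> \<in> Vdot n"
      then have "base u = base v" if "u \<in> {\<alpha>, bar \<alpha>}" "v \<in> {\<alpha>, bar \<alpha>}" for u v
        using that by (auto simp: base_bar)
      then show "card (x \<inter> {\<alpha>, bar \<alpha>}) \<le> 1"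
        using * card_le_Suc0_iff_eq[of "x \<inter> {\<alpha>, bar \<alpha>}"] by (auto dest: inj_onD)
    qed
  qed
  show ?thesis
    using sub inj by (auto simp: L_def transversals_def card_image)
qed

lemma transversals_empty: "transversals {} = {{}}"
  by (auto simp: transversals_def)

lemma insert_transversal:
  assumes "x \<in> transversals c" "base v \<notin> c"
  shows "insert v x \<in> transversals (insert (base v) c)" "v \<notin> x"
  using assms by (auto simp: transversals_def)

lemma transversals_insert:
  assumes \<alpha>: "\<alpha> \<in> Vdot n" "\<alpha> \<notin> c"
  shows "transversals (insert \<alpha> c) = insert \<alpha> ` transversals c \<union> insert (bar \<alpha>) ` transversals c"
proof (intro equalityI subsetI)
  fix x assume x: "x \<in> transversals (insert \<alpha> c)"
  then have "\<alpha> \<in> base ` x"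
    unfolding transversals_def by blast
  then obtain v where v: "v \<in> x" "base v = \<alpha>"
    by auto
  have "x - {v} \<in> transversals c"
    using x v \<alpha>(2) by (auto simp: transversals_def inj_on_def)
  moreover have "x = insert v (x - {v})"
    using v by auto
  ultimately show "x \<in> insert \<alpha> ` transversals c \<union> insert (bar \<alpha>) ` transversals c"
    using base_eq_iff[OF \<alpha>(1), of v] v(2) by (metis UnCI image_eqI)
next
  fix x assume "x \<in> insert \<alpha> ` transversals c \<union> insert (bar \<alpha>) ` transversals c"
  then show "x \<in> transversals (insert \<alpha> c)"
    using insert_transversal(1)[of _ c \<alpha>] insert_transversal(1)[of _ c "bar \<alpha>"] \<alpha>(2)
    unfolding base_bar base_Vdot[OF \<alpha>(1)] by blast
qed

lemma finite_transversals:
  assumes "c \<subseteq> Vdot n"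
  shows "finite (transversals c)"
proof (rule finite_subset)
  show "transversals c \<subseteq> Pow (c \<union> bar ` c)"
    using base_vimage[OF assms] by (auto simp: transversals_def)
  show "finite (Pow (c \<union> bar ` c))"
    using assms finite_Vdot finite_subset by auto
qed

text \<open>Expanding the product means choosing one summand per pair. The general semiring allows
  both uses: polynomials for expanding brackets, field elements for the character sums.\<close>

lemma prod_pairs_eq_sum_transversals:
  fixes h :: "vertex \<Rightarrow> 'a::comm_semiring_1"
  assumes "c \<subseteq> Vdot n"
  shows "(\<Prod>\<alpha>\<in>c. h \<alpha> + h (bar \<alpha>)) = (\<Sum>x\<in>transversals c. \<Prod>v\<in>x. h v)"
proof -
  have "finite c"
    using assms finite_Vdot finite_subset by blast
  then show ?thesis
    using assms
  proof (induction c rule: finite_induct)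
    case empty
    then show ?case by (simp add: transversals_empty)
  next
    case (insert \<alpha> c)
    then have \<alpha>: "\<alpha> \<in> Vdot n" "\<alpha> \<notin> c" and c: "c \<subseteq> Vdot n" by auto
    have notin: "v \<notin> x" if "x \<in> transversals c" "v \<in> {\<alpha>, bar \<alpha>}" for x v
      using insert_transversal(2)[OF that(1), of v] that(2) \<alpha> by (auto simp: base_bar base_Vdot)
    have "\<alpha> \<noteq> bar \<alpha>"
      by (cases \<alpha>) auto
    then have disj: "insert \<alpha> ` transversals c \<inter> insert (bar \<alpha>) ` transversals c = {}"
      using notin by blast
    have half: "(\<Sum>x\<in>insert v ` transversals c. \<Prod>v\<in>x. h v) =
        h v * (\<Sum>x\<in>transversals c. \<Prod>v\<in>x. h v)" if v: "v \<in> {\<alpha>, bar \<alpha>}" for v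
    proof -
      have "inj_on (insert v) (transversals c)"
        using notin v by (metis inj_onI insert_ident)
      then have "(\<Sum>x\<in>insert v ` transversals c. \<Prod>v\<in>x. h v) =
          (\<Sum>x\<in>transversals c. \<Prod>v\<in>insert v x. h v)"
        by (simp add: sum.reindex)
      also have "\<dots> = (\<Sum>x\<in>transversals c. h v * (\<Prod>v\<in>x. h v))"
        using notin[OF _ v] finite_transversal[OF _ c] by (intro sum.cong) auto
      finally show ?thesis
        by (simp add: sum_distrib_left)
    qed
    have "(\<Sum>x\<in>transversals (insert \<alpha> c). \<Prod>v\<in>x. h v) =
        (h \<alpha> + h (bar \<alpha>)) * (\<Sum>x\<in>transversals c. \<Prod>v\<in>x. h v)"
      unfolding transversals_insert[OF \<alpha>]
      by (subst sum.union_disjoint) (simp_all add: finite_transversals[OF c] disj half distrib_right)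
    then show ?case
      using insert by simp
  qed
qed

section \<open>The maps \<open>eps\<close> and \<open>bd\<close> on faces\<close>

lemma smul_mult: "p * smul c q = smul c (p * q)" "smul c p * q = smul c (p * q)"
  by (simp_all add: smul_def ac_simps)

lemma smul_numeral: "smul (numeral k) p = numeral k * p"
  by (simp add: smul_def flip: single_numeral)

lemma smul_of_nat: "smul (of_nat k) p = of_nat k * p"
  by (simp add: smul_def flip: single_of_nat)

lemma lookup_smul: "Poly_Mapping.lookup (smul c p) k = c * Poly_Mapping.lookup p k"
  by (simp add: smul_def Poly_Mapping.map.rep_eq when_def flip: mult_map_scale_conv_mult)

lemma lookup_face:
  "finite x \<Longrightarrow> finite y \<Longrightarrow>
    Poly_Mapping.lookup (face x) (mset_set y) = (if x = y then 1 else 0)"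
  by (auto simp: face_def lookup_single when_def mset_set_eq_iff)

lemma face_insert: "finite x \<Longrightarrow> v \<notin> x \<Longrightarrow> face (insert v x) = var v * face x"
  by (simp add: face_def var_def mult_single)

lemma prod_var: "finite x \<Longrightarrow> (\<Prod>v\<in>x. var v) = face x"
proof (induction x rule: finite_induct)
  case empty
  then show ?case by (simp add: face_def)
qed (simp add: face_insert)

lemma linear_lin_ext: "Vector_Spaces.linear smul smul (lin_ext n g)"
  unfolding linear_iff_module_hom[symmetric]
  by unfold_locales
    (simp_all add: lin_ext_def lookup_add lookup_smul vp.scale_left_distrib sum.distrib
      vp.scale_sum_right)

lemma linear_eps: "Vector_Spaces.linear smul smul (eps n)"
  and linear_bd: "Vector_Spaces.linear smul smul (bd n)"
  unfolding eps_def bd_def by (rule linear_lin_ext)+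

lemma lin_ext_face:
  assumes "x \<in> transversals c" "c \<subseteq> Vdot n"
  shows "lin_ext n g (face x) = g x"
proof -
  let ?L = "\<Union>k\<le>n. L n k"
  have fin: "finite y" if "y \<in> ?L" for y
    using that finite_transversal unfolding mem_L_iff UN_iff by blast
  have "card c \<le> n"
    using card_mono[OF finite_Vdot assms(2)] by (simp add: card_Vdot)
  moreover have "x \<in> L n (card c)"
    using assms mem_L_iff by blast
  ultimately have x: "x \<in> ?L"
    by blast
  have "?L \<subseteq> (\<Union>c\<in>Pow (Vdot n). transversals c)"
    unfolding mem_L_iff subset_iff UN_iff Pow_iff by blast
  then have "finite ?L"
    by (rule finite_subset) (auto simp: finite_Vdot intro: finite_transversals)
  moreover have "lin_ext n g (face x) = (\<Sum>y\<in>?L. if x = y then g y else 0)"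
    unfolding lin_ext_def by (intro sum.cong) (auto simp: lookup_face fin[OF x] fin)
  ultimately show ?thesis
    using x by simp
qed

lemma card_transversal: "x \<in> transversals c \<Longrightarrow> card x = card c"
  by (auto simp: transversals_def card_image)

text \<open>A face with one more vertex than \<open>x\<close> adds a vertex from a pair outside the
  support \<open>c\<close>, and each such vertex is allowed. The resulting multiplier depends only
  on \<open>c\<close>, so \<open>eps_transversal_span\<close> can extend it linearly.\<close>

lemma eps_face:
  assumes x: "x \<in> transversals c" and c: "c \<subseteq> Vdot n"
  shows "eps n (face x) = (\<Sum>\<alpha>\<in>Vdot n - c. var \<alpha> + var (bar \<alpha>)) * face x"
proof -
  let ?C = "Vdot n - c"
  have fin: "finite x" "finite c"
    using x c finite_transversal finite_Vdot finite_subset by blast+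
  have notin: "v \<notin> x" if "v \<in> ?C \<union> bar ` ?C" for v
    using insert_transversal(2)[OF x, of v] that base_vimage[of ?C n] by auto
  have Y: "{y. y \<in> L n (card x + 1) \<and> x \<subset> y} = (\<lambda>v. insert v x) ` (?C \<union> bar ` ?C)" (is "?Y = ?I")
  proof (intro equalityI subsetI)
    fix y assume "y \<in> ?Y"
    then obtain c' where c': "c' \<subseteq> Vdot n" "y \<in> transversals c'" "card y = card x + 1" "x \<subset> y"
      by (auto simp: mem_L_iff card_transversal)
    have "finite y"
      using c' finite_transversal by blast
    then have "card (y - x) = 1"
      using c' fin by (simp add: card_Diff_subset psubset_eq)
    then obtain v where v: "y - x = {v}"
      using card_1_singletonE by blast
    then have y: "y = insert v x" "v \<notin> x"
      using c'(4) by auto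
    then have "base v \<in> ?C"
      using x c' by (force simp: transversals_def)
    then show "y \<in> ?I"
      using y base_vimage[of ?C n] by auto
  next
    fix y assume "y \<in> ?I"
    then obtain v where v: "base v \<in> ?C" "y = insert v x" "v \<notin> x"
      using notin base_vimage[of ?C n] by auto
    then have "y \<in> transversals (insert (base v) c)"
      using insert_transversal(1)[OF x] by auto
    then show "y \<in> ?Y"
      using v c fin by (auto simp: mem_L_iff card_transversal[OF x] intro!: exI[of _ "insert (base v) c"])
  qed
  have inj: "inj_on (\<lambda>v. insert v x) (?C \<union> bar ` ?C)"
    using notin by (intro inj_onI) blast
  have "eps n (face x) = (\<Sum>v\<in>?C \<union> bar ` ?C. var v * face x)"
    using notin fin
    by (simp add: eps_def lin_ext_face[OF x c] Y[simplified] sum.reindex[OF inj] face_insert)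
  also have "\<dots> = (\<Sum>\<alpha>\<in>?C. var \<alpha> * face x) + (\<Sum>v\<in>bar ` ?C. var v * face x)"
    using finite_Vdot bar_notin_Vdot by (intro sum.union_disjoint) auto
  also have "(\<Sum>v\<in>bar ` ?C. var v * face x) = (\<Sum>\<alpha>\<in>?C. var (bar \<alpha>) * face x)"
    by (subst sum.reindex) (auto simp: inj_on_def bar_eq_iff)
  finally show ?thesis
    by (simp add: sum_distrib_right distrib_right sum.distrib)
qed

lemma bd_face:
  assumes x: "x \<in> transversals c" and c: "c \<subseteq> Vdot n"
  shows "bd n (face x) = (\<Sum>v\<in>x. face (x - {v}))"
proof -
  have fin: "finite x"
    using x c finite_transversal by blast
  have Z: "{z. z \<in> L n (card x - 1) \<and> z \<subset> x} = (\<lambda>v. x - {v}) ` x" (is "?Z = ?I")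
  proof (intro equalityI subsetI)
    fix z assume "z \<in> ?Z"
    then have z: "card z = card x - 1" "z \<subset> x"
      by (auto simp: mem_L_iff card_transversal)
    \<comment> \<open>Strict inclusion makes \<open>x\<close> nonempty, so the truncated
      \<open>card x - 1\<close> is the true predecessor.\<close>
    then have "card z < card x" "finite z"
      using fin psubset_card_mono finite_subset by blast+
    then have "card (x - z) = 1"
      using z by (subst card_Diff_subset) auto
    then obtain v where "x - z = {v}"
      using card_1_singletonE by blast
    then have "z = x - {v}" "v \<in> x"
      using z(2) by auto
    then show "z \<in> ?I" by blast
  next
    fix z assume "z \<in> ?I"
    then obtain v where v: "v \<in> x" "z = x - {v}" by auto
    then have "z \<in> transversals (base ` z)" "base ` z \<subseteq> Vdot n"
      using x c by (auto simp: transversals_def inj_on_def)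
    then show "z \<in> ?Z"
      using v fin card_transversal[of z "base ` z"] by (auto simp: mem_L_iff)
  qed
  have "inj_on (\<lambda>v. x - {v}) x"
    by (intro inj_onI) blast
  then show ?thesis
    by (simp add: bd_def lin_ext_face[OF x c] Z[simplified] sum.reindex)
qed

lemma eps_transversal_span:
  assumes "p \<in> vp.span (face ` transversals c)" and c: "c \<subseteq> Vdot n"
  shows "eps n p = (\<Sum>\<alpha>\<in>Vdot n - c. var \<alpha> + var (bar \<alpha>)) * p"
  using assms(1)
proof (induction rule: vp.span_induct_alt)
  case base
  then show ?case by (simp add: linear_smul_algebra[OF linear_eps])
next
  case (step a q p)
  then show ?case
    by (auto simp: linear_smul_algebra[OF linear_eps] eps_face[OF _ c] distrib_left smul_mult)
qed

text \<open>Leibniz rule: on faces \<open>bd\<close> acts as the derivation sending every vertex to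
  1. The pair of \<open>v\<close> has to be new so that the products are again faces.\<close>

lemma bd_var_mult:
  assumes "p \<in> vp.span (face ` transversals c)" and c: "c \<subseteq> Vdot n" and v: "base v \<in> Vdot n - c"
  shows "bd n (var v * p) = p + var v * bd n p"
  using assms(1)
proof (induction rule: vp.span_induct_alt)
  case base
  then show ?case by (simp add: linear_smul_algebra[OF linear_bd])
next
  case (step a q p)
  then obtain x where x: "x \<in> transversals c" and q: "q = face x"
    by auto
  have fin: "finite x" and vx: "v \<notin> x"
    using x c v finite_transversal insert_transversal(2)[OF x] by blast+
  have "bd n (var v * q) = bd n (face (insert v x))"
    by (simp add: q face_insert fin vx)
  also have "\<dots> = (\<Sum>w\<in>insert v x. face (insert v x - {w}))"
    using insert_transversal(1)[OF x] v c by (intro bd_face[of _ "insert (base v) c"]) auto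
  also have "\<dots> = face x + (\<Sum>w\<in>x. face (insert v (x - {w})))"
    using fin vx by (auto simp: insert_Diff_if intro!: sum.cong)
  also have "\<dots> = q + var v * bd n q"
    using fin vx by (simp add: q bd_face[OF x c] face_insert sum_distrib_left)
  finally show ?case
    using step
    by (simp add: linear_smul_algebra[OF linear_bd] distrib_left smul_mult vp.scale_right_distrib)
qed

lemma var_mult_transversal_span:
  assumes "p \<in> vp.span (face ` transversals c)" and c: "c \<subseteq> Vdot n" and v: "base v \<notin> c"
  shows "var v * p \<in> vp.span (face ` transversals (insert (base v) c))"
  using assms(1)
proof (induction rule: vp.span_induct_alt)
  case base
  then show ?case by (simp add: vp.span_zero)
next
  case (step a q p)
  then obtain x where x: "x \<in> transversals c" and q: "q = face x"
    by auto
  have "var v * q = face (insert v x)"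
    using x c finite_transversal insert_transversal(2)[OF x v] by (simp add: q face_insert)
  then have "var v * q \<in> face ` transversals (insert (base v) c)"
    using insert_transversal(1)[OF x v] by simp
  then show ?case
    using step by (simp add: distrib_left smul_mult vp.span_add vp.span_scale vp.span_base)
qed

section \<open>The maps on brackets\<close>

lemma bracket_insert:
  assumes "finite a" "\<alpha> \<notin> a"
  shows bracket_insert_left: "bracket (insert \<alpha> a) b = (var \<alpha> + var (bar \<alpha>)) * bracket a b"
    and bracket_insert_right: "bracket b (insert \<alpha> a) = (var \<alpha> - var (bar \<alpha>)) * bracket b a"
  using assms by (simp_all add: bracket_def ac_simps)

text \<open>The derivation sends a sum \<alpha> + bar \<alpha> to 2 and a difference to 0; hence
  \<open>bd\<close> removes elements of the first entry of a bracket and treats the second entry as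
  constant.\<close>

lemma pair_mult_transversal_span:
  assumes p: "p \<in> vp.span (face ` transversals c)" and c: "c \<subseteq> Vdot n" and \<alpha>: "\<alpha> \<in> Vdot n - c"
  shows "(var \<alpha> + var (bar \<alpha>)) * p \<in> vp.span (face ` transversals (insert \<alpha> c))"
    and "(var \<alpha> - var (bar \<alpha>)) * p \<in> vp.span (face ` transversals (insert \<alpha> c))"
    and "bd n ((var \<alpha> + var (bar \<alpha>)) * p) = smul 2 p + (var \<alpha> + var (bar \<alpha>)) * bd n p"
    and "bd n ((var \<alpha> - var (bar \<alpha>)) * p) = (var \<alpha> - var (bar \<alpha>)) * bd n p"
proof -
  have b: "base \<alpha> = \<alpha>" "base (bar \<alpha>) = \<alpha>"
    using \<alpha> by (auto simp: base_bar base_Vdot)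
  show "(var \<alpha> + var (bar \<alpha>)) * p \<in> vp.span (face ` transversals (insert \<alpha> c))"
    "(var \<alpha> - var (bar \<alpha>)) * p \<in> vp.span (face ` transversals (insert \<alpha> c))"
    using var_mult_transversal_span[OF p c, of \<alpha>] var_mult_transversal_span[OF p c, of "bar \<alpha>"] \<alpha>
    by (auto simp: b distrib_right left_diff_distrib intro!: vp.span_add vp.span_diff)
  show "bd n ((var \<alpha> + var (bar \<alpha>)) * p) = smul 2 p + (var \<alpha> + var (bar \<alpha>)) * bd n p"
    "bd n ((var \<alpha> - var (bar \<alpha>)) * p) = (var \<alpha> - var (bar \<alpha>)) * bd n p"
    using bd_var_mult[OF p c, of \<alpha>] bd_var_mult[OF p c, of "bar \<alpha>"] \<alpha>
    by (simp_all add: b distrib_right left_diff_distrib linear_smul_algebra[OF linear_bd]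
        smul_numeral)
qed

text \<open>Support and boundary are proved in one induction, since the Leibniz rule needs the
  support of the shorter bracket.\<close>

lemma bracket_empty_span:
  assumes "finite b" "b \<subseteq> Vdot n"
  shows "(bracket {} b :: 'f::field vpoly) \<in> vp.span (face ` transversals b) \<and>
    bd n (bracket {} b :: 'f vpoly) = 0"
  using assms
proof (induction b rule: finite_induct)
  case empty
  have "bracket {} {} = (face {} :: 'f vpoly)"
    by (simp add: bracket_def face_def)
  then show ?case
    using bd_face[of "{}" "{}" n]
    by (simp add: transversals_empty vp.span_base)
next
  case (insert \<beta> b)
  then show ?case
    using pair_mult_transversal_span[of "bracket {} b :: 'f vpoly" b n \<beta>] by (simp add: bracket_insert_right)
qed

lemma bracket_span_bd:
  assumes "finite a" "a \<subseteq> Vdot n" "b \<subseteq> Vdot n" "a \<inter> b = {}"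
  shows "(bracket a b :: 'f::field vpoly) \<in> vp.span (face ` transversals (a \<union> b)) \<and>
    bd n (bracket a b :: 'f vpoly) = (\<Sum>\<alpha>\<in>a. smul 2 (bracket (a - {\<alpha>}) b))"
  using assms
proof (induction a rule: finite_induct)
  case empty
  then show ?case
    using bracket_empty_span[of b n] finite_Vdot finite_subset by auto
next
  case (insert \<alpha> a)
  have "bd n (bracket (insert \<alpha> a) b :: 'f vpoly) =
      smul 2 (bracket a b) + (\<Sum>\<alpha>'\<in>a. smul 2 ((var \<alpha> + var (bar \<alpha>)) * bracket (a - {\<alpha>'}) b))"
    using insert pair_mult_transversal_span(3)[of "bracket a b :: 'f vpoly" "a \<union> b" n \<alpha>]
    by (simp add: bracket_insert_left sum_distrib_left smul_mult)
  also have "(\<Sum>\<alpha>'\<in>a. smul 2 ((var \<alpha> + var (bar \<alpha>)) * bracket (a - {\<alpha>'}) b)) =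
      (\<Sum>\<alpha>'\<in>a. smul 2 (bracket (insert \<alpha> a - {\<alpha>'}) b))"
    using insert.hyps by (intro sum.cong) (auto simp: insert_Diff_if bracket_insert_left)
  finally show ?case
    using insert pair_mult_transversal_span(1)[of "bracket a b :: 'f vpoly" "a \<union> b" n \<alpha>]
    by (simp add: bracket_insert_left)
qed

lemma eps_bracket:
  assumes "a \<subseteq> Vdot n" "b \<subseteq> Vdot n" "a \<inter> b = {}"
  shows "eps n (bracket a b :: 'f::field vpoly) = (\<Sum>\<alpha>\<in>Vdot n - (a \<union> b). bracket (insert \<alpha> a) b)"
proof -
  have "finite a"
    using assms finite_Vdot finite_subset by blast
  then show ?thesis
    using bracket_span_bd[of a n b, where 'f = 'f] assms
      eps_transversal_span[of "bracket a b :: 'f vpoly" "a \<union> b" n]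
    by (simp add: sum_distrib_right bracket_insert_left)
qed

section \<open>Independence and number of the brackets\<close>

definition bracket_index :: "nat \<Rightarrow> nat \<Rightarrow> nat \<Rightarrow> (vertex set \<times> vertex set) set" where
  "bracket_index n t j =
    {(a, b). a \<subseteq> Vdot n \<and> b \<subseteq> Vdot n \<and> a \<inter> b = {} \<and> card a = t \<and> card b = j}"

lemma E_eq_span: "E n (j + t) j = vp.span (case_prod bracket ` bracket_index n t j)"
  unfolding E_def by (rule arg_cong[of _ _ vp.span]) (auto simp: bracket_index_def)

lemma finite_bracket_index: "finite (bracket_index n t j)"
proof (rule finite_subset)
  show "bracket_index n t j \<subseteq> Pow (Vdot n) \<times> Pow (Vdot n)"
    by (auto simp: bracket_index_def)
qed (simp add: finite_Vdot)

text \<open>Count by choosing \<open>b\<close> first and then \<open>a\<close> among the remaining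
  \<open>n - j\<close> elements.\<close>

lemma card_bracket_index: "card (bracket_index n t j) = (n choose j) * ((n - j) choose t)"
proof -
  let ?B = "{b. b \<subseteq> Vdot n \<and> card b = j}"
  let ?A = "\<lambda>b. {a. a \<subseteq> Vdot n - b \<and> card a = t}"
  have "bracket_index n t j = prod.swap ` Sigma ?B ?A"
    by (auto simp: bracket_index_def image_iff)
  then have "card (bracket_index n t j) = card (Sigma ?B ?A)"
    by (simp add: card_image)
  also have "\<dots> = (\<Sum>b\<in>?B. card (?A b))"
    by (intro card_SigmaI) (auto simp: finite_Vdot)
  also have "\<dots> = (\<Sum>b\<in>?B. (n - j) choose t)"
  proof (rule sum.cong)
    fix b assume "b \<in> ?B"
    then show "card (?A b) = (n - j) choose t"
      using n_subsets[of "Vdot n - b" t] finite_Vdot[of n] card_Vdot[of n]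
      by (auto simp: card_Diff_subset finite_subset)
  qed simp
  also have "\<dots> = (n choose j) * ((n - j) choose t)"
    using n_subsets[OF finite_Vdot, of n j] by (simp add: card_Vdot)
  finally show ?thesis .
qed

text \<open>Multiplied over a transversal, these signs give the coefficient of its face in
  \<open>bracket a b\<close>.\<close>

definition sign :: "vertex set \<Rightarrow> vertex \<Rightarrow> 'f::field" where
  "sign b v = (if v \<in> bar ` b then - 1 else 1)"

text \<open>Absorbing the signs into the vertices gives the factors from \<open>a\<close> and from
  \<open>b\<close> the common shape \<open>?h \<alpha> + ?h (bar \<alpha>)\<close>, so the whole
  product expands at once.\<close>

lemma bracket_expansion:
  assumes ab: "a \<subseteq> Vdot n" "b \<subseteq> Vdot n" "a \<inter> b = {}"
  shows "(bracket a b :: 'f::field vpoly) =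
    (\<Sum>x\<in>transversals (a \<union> b). smul (\<Prod>v\<in>x. sign b v) (face x))"
proof -
  let ?h = "\<lambda>v. smul (sign b v) (var v) :: 'f vpoly"
  have fin: "finite a" "finite b"
    using ab finite_Vdot finite_subset by blast+
  have h: "?h \<alpha> = var \<alpha>" if "\<alpha> \<in> Vdot n" for \<alpha>
    using that ab bar_notin_Vdot by (auto simp: sign_def)
  have "(\<Prod>\<alpha>\<in>a. var \<alpha> + var (bar \<alpha>)) = (\<Prod>\<alpha>\<in>a. ?h \<alpha> + ?h (bar \<alpha>))"
  proof (rule prod.cong)
    fix \<alpha> assume "\<alpha> \<in> a"
    then have "bar \<alpha> \<notin> bar ` b" "\<alpha> \<in> Vdot n"
      using ab by (auto simp: bar_eq_iff)
    then show "var \<alpha> + var (bar \<alpha>) = ?h \<alpha> + ?h (bar \<alpha>)"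
      by (simp add: h) (simp add: sign_def)
  qed simp
  moreover have "(\<Prod>\<alpha>\<in>b. var \<alpha> - var (bar \<alpha>)) = (\<Prod>\<alpha>\<in>b. ?h \<alpha> + ?h (bar \<alpha>))"
  proof (rule prod.cong)
    fix \<beta> assume "\<beta> \<in> b"
    then have "bar \<beta> \<in> bar ` b" "\<beta> \<in> Vdot n"
      using ab by auto
    then show "var \<beta> - var (bar \<beta>) = ?h \<beta> + ?h (bar \<beta>)"
      by (simp add: h) (simp add: sign_def)
  qed simp
  ultimately have "bracket a b = (\<Prod>\<alpha>\<in>a \<union> b. ?h \<alpha> + ?h (bar \<alpha>))"
    using fin ab(3) by (simp add: bracket_def prod.union_disjoint)
  also have "\<dots> = (\<Sum>x\<in>transversals (a \<union> b). \<Prod>v\<in>x. ?h v)"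
    using ab by (intro prod_pairs_eq_sum_transversals[of _ n]) auto
  also have "\<dots> = (\<Sum>x\<in>transversals (a \<union> b). smul (\<Prod>v\<in>x. sign b v) (face x))"
  proof (rule sum.cong)
    fix x assume "x \<in> transversals (a \<union> b)"
    then have fin: "finite x"
      using ab finite_transversal[of x "a \<union> b" n] by blast
    have "(\<Prod>v\<in>y. ?h v) = smul (\<Prod>v\<in>y. sign b v) (\<Prod>v\<in>y. var v)" if "finite y" for y
      using that by (induction y rule: finite_induct) (simp_all add: smul_mult)
    then show "(\<Prod>v\<in>x. ?h v) = smul (\<Prod>v\<in>x. sign b v) (face x)"
      using fin by (simp add: prod_var)
  qed simp
  finally show ?thesis .
qed

text \<open>The functional that pairs a polynomial with the coefficients of \<open>bracket a b\<close>; up to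
  a power of 2 these functionals are dual to the brackets, by orthogonality of characters.\<close>

definition pairing :: "vertex set \<Rightarrow> vertex set \<Rightarrow> 'f vpoly \<Rightarrow> 'f::field" where
  "pairing a b p =
    (\<Sum>x\<in>transversals (a \<union> b). (\<Prod>v\<in>x. sign b v) * Poly_Mapping.lookup p (mset_set x))"

lemma pairing_sum:
  fixes g :: "'i \<Rightarrow> 'f::field vpoly"
  shows "pairing a b (\<Sum>i\<in>I. smul (u i) (g i)) = (\<Sum>i\<in>I. u i * pairing a b (g i))"
proof -
  have "pairing a b (smul c p + q) = c * pairing a b p + pairing a b q"
    for c and p q :: "'f vpoly"
    by (simp add: pairing_def lookup_add lookup_smul sum_distrib_left sum.distrib algebra_simps)
  moreover have "pairing a b (0 :: 'f vpoly) = 0"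
    by (simp add: pairing_def)
  ultimately show ?thesis
    by (induction I rule: infinite_finite_induct) simp_all
qed

text \<open>Different supports have no common transversal. For equal supports the sum factors over
  the pairs, with factor 2 if \<open>b\<close> and \<open>b'\<close> agree at \<alpha> and factor 0
  otherwise; so only \<open>b = b'\<close> survives, and then \<open>a = a'\<close>.\<close>

lemma pairing_bracket:
  assumes ab: "a \<subseteq> Vdot n" "b \<subseteq> Vdot n" "a \<inter> b = {}"
    and ab': "a' \<subseteq> Vdot n" "b' \<subseteq> Vdot n" "a' \<inter> b' = {}"
  shows "pairing a' b' (bracket a b :: 'f::field vpoly) =
    (if a = a' \<and> b = b' then 2 ^ card (a \<union> b) else 0)"
proof -
  let ?c = "a \<union> b" and ?c' = "a' \<union> b'"
  have c: "?c \<subseteq> Vdot n" "?c' \<subseteq> Vdot n" and fin: "finite ?c"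
    using ab ab' finite_Vdot finite_subset by blast+
  have lookup: "Poly_Mapping.lookup (bracket a b :: 'f vpoly) (mset_set y) =
      (if y \<in> transversals ?c then \<Prod>v\<in>y. sign b v else 0)" if "finite y" for y
  proof -
    have "Poly_Mapping.lookup (bracket a b :: 'f vpoly) (mset_set y) =
        (\<Sum>x\<in>transversals ?c. if y = x then \<Prod>v\<in>x. sign b v else 0)"
      unfolding bracket_expansion[OF ab] lookup_sum
      using that finite_transversal[OF _ c(1)]
      by (intro sum.cong) (auto simp: lookup_smul lookup_face)
    then show ?thesis
      by (simp add: finite_transversals[OF c(1)])
  qed
  have eq: "pairing a' b' (bracket a b :: 'f vpoly) = (\<Sum>x\<in>transversals ?c'. (\<Prod>v\<in>x. sign b' v) *
      (if x \<in> transversals ?c then \<Prod>v\<in>x. sign b v else 0))"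
    unfolding pairing_def using finite_transversal[OF _ c(2)] by (intro sum.cong) (auto simp: lookup)
  show ?thesis
  proof (cases "?c = ?c'")
    case False
    then have "transversals ?c \<inter> transversals ?c' = {}"
      by (auto simp: transversals_def)
    then have "pairing a' b' (bracket a b :: 'f vpoly) = 0"
      unfolding eq by (intro sum.neutral) auto
    then show ?thesis
      using False by auto
  next
    case True
    have "pairing a' b' (bracket a b :: 'f vpoly) =
        (\<Sum>x\<in>transversals ?c. \<Prod>v\<in>x. sign b' v * sign b v)"
      unfolding eq True by (intro sum.cong) (auto simp: prod.distrib)
    also have "\<dots> = (\<Prod>\<alpha>\<in>?c. sign b' \<alpha> * sign b \<alpha> + sign b' (bar \<alpha>) * sign b (bar \<alpha>))"
      by (rule prod_pairs_eq_sum_transversals[OF c(1), symmetric])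
    also have "\<dots> = (\<Prod>\<alpha>\<in>?c. if \<alpha> \<in> b \<longleftrightarrow> \<alpha> \<in> b' then 2 else 0)"
    proof (rule prod.cong)
      fix \<alpha> assume "\<alpha> \<in> ?c"
      then have "\<alpha> \<notin> bar ` b" "\<alpha> \<notin> bar ` b'"
        using c ab(2) ab'(2) bar_notin_Vdot by blast+
      then show "sign b' \<alpha> * sign b \<alpha> + sign b' (bar \<alpha>) * sign b (bar \<alpha>) =
          (if \<alpha> \<in> b \<longleftrightarrow> \<alpha> \<in> b' then 2 else (0 :: 'f))"
        by (auto simp: sign_def bar_eq_iff image_iff)
    qed simp
    also have "\<dots> = (if a = a' \<and> b = b' then 2 ^ card ?c else 0)"
    proof (cases "b = b'")
      case b: True
      then have "a = a'"
        using True ab(3) ab'(3) by blast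
      with b show ?thesis by simp
    next
      case b: False
      then have "\<exists>\<alpha>\<in>?c. \<not> (\<alpha> \<in> b \<longleftrightarrow> \<alpha> \<in> b')"
        using True by blast
      then show ?thesis
        using b fin by (subst prod_zero) auto
    qed
    finally show ?thesis .
  qed
qed

text \<open>Pairing a linear relation with one bracket isolates its coefficient times a power of 2,
  which is invertible. The same duality shows that distinct index pairs give distinct
  brackets.\<close>

lemma dim_E:
  assumes two: "(2 :: 'f::field) \<noteq> 0"
  shows "vp.dim (E n (j + t) j :: 'f vpoly set) = (n choose j) * ((n - j) choose t)"
proof -
  let ?P = "bracket_index n t j"
  let ?f = "case_prod bracket :: _ \<Rightarrow> 'f vpoly"
  have dual: "pairing (fst q) (snd q) (?f p) = (if p = q then 2 ^ card (fst p \<union> snd p) else (0 :: 'f))"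
    if "p \<in> ?P" "q \<in> ?P" for p q
    using that by (cases p; cases q) (simp add: bracket_index_def pairing_bracket[where n = n])
  have inj: "inj_on ?f ?P"
  proof (rule inj_onI, rule ccontr)
    fix p q assume pq: "p \<in> ?P" "q \<in> ?P" "?f p = ?f q" "p \<noteq> q"
    then have "(2 :: 'f) ^ card (fst q \<union> snd q) = 0"
      using dual[of q q] dual[of p q] by simp
    then show False
      using two by simp
  qed
  have "vp.independent (?f ` ?P)"
  proof (rule vp.independent_if_scalars_zero)
    show "finite (?f ` ?P)"
      by (simp add: finite_bracket_index)
    fix u x assume sum: "(\<Sum>x\<in>?f ` ?P. smul (u x) x) = 0" and x: "x \<in> ?f ` ?P"
    then obtain q where q: "q \<in> ?P" "x = ?f q" by blast
    have "0 = pairing (fst q) (snd q) (\<Sum>p\<in>?P. smul (u (?f p)) (?f p))"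
      using sum by (simp add: sum.reindex[OF inj] pairing_def)
    also have "\<dots> = (\<Sum>p\<in>?P. u (?f p) * pairing (fst q) (snd q) (?f p))"
      by (rule pairing_sum)
    also have "\<dots> = (\<Sum>p\<in>?P. if p = q then u (?f p) * 2 ^ card (fst p \<union> snd p) else 0)"
      using q by (intro sum.cong) (simp_all add: dual del: split_paired_All split: if_splits)
    also have "\<dots> = u x * 2 ^ card (fst q \<union> snd q)"
      using q by (simp add: finite_bracket_index)
    finally show "u x = 0"
      using two by simp
  qed
  then have "vp.dim (E n (j + t) j :: 'f vpoly set) = card (?f ` ?P)"
    by (simp add: E_eq_span vp.dim_eq_card_independent)
  then show ?thesis
    by (simp add: card_image[OF inj] card_bracket_index)
qed

section \<open>The spectral decomposition\<close>

lemma linear_span_into: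
  assumes "Vector_Spaces.linear smul smul T" "v \<in> vp.span S"
    and "\<And>p. p \<in> S \<Longrightarrow> T p \<in> vp.span S'"
  shows "T v \<in> vp.span S'"
  using assms(2)
proof (induction rule: vp.span_induct_alt)
  case base
  then show ?case by (simp add: linear_smul_algebra[OF assms(1)] vp.span_zero)
next
  case (step a q p)
  then show ?case
    by (simp add: linear_smul_algebra[OF assms(1)] assms(3) vp.span_add vp.span_scale)
qed

lemma eps_E: "v \<in> E n (j + t) j \<Longrightarrow> eps n v \<in> E n (j + Suc t) j"
  unfolding E_eq_span
proof (erule linear_span_into[OF linear_eps])
  fix p :: "'a vpoly" assume "p \<in> case_prod bracket ` bracket_index n t j"
  then obtain a b where p: "p = bracket a b" and ab: "a \<subseteq> Vdot n" "b \<subseteq> Vdot n" "a \<inter> b = {}"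
      "card a = t" "card b = j"
    by (auto simp: bracket_index_def)
  have "finite a"
    using ab finite_Vdot finite_subset by blast
  then have "(insert \<alpha> a, b) \<in> bracket_index n (Suc t) j" if "\<alpha> \<in> Vdot n - (a \<union> b)" for \<alpha>
    using that ab by (auto simp: bracket_index_def)
  then show "eps n p \<in> vp.span (case_prod bracket ` bracket_index n (Suc t) j)"
    unfolding p eps_bracket[OF ab(1-3)]
    by (intro vp.span_sum vp.span_base) (force intro: rev_image_eqI)
qed

lemma bd_E: "v \<in> E n (j + Suc t) j \<Longrightarrow> bd n v \<in> E n (j + t) j"
  unfolding E_eq_span
proof (erule linear_span_into[OF linear_bd])
  fix p :: "'a vpoly" assume "p \<in> case_prod bracket ` bracket_index n (Suc t) j"
  then obtain a b where p: "p = bracket a b" and ab: "a \<subseteq> Vdot n" "b \<subseteq> Vdot n" "a \<inter> b = {}"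
      "card a = Suc t" "card b = j"
    by (auto simp: bracket_index_def)
  have fin: "finite a"
    using ab finite_Vdot finite_subset by blast
  then have "(a - {\<alpha>}, b) \<in> bracket_index n t j" if "\<alpha> \<in> a" for \<alpha>
    using that ab by (auto simp: bracket_index_def)
  moreover have "bd n p = (\<Sum>\<alpha>\<in>a. smul 2 (bracket (a - {\<alpha>}) b))"
    using bracket_span_bd[OF fin ab(1-3)] p by blast
  ultimately show "bd n p \<in> vp.span (case_prod bracket ` bracket_index n t j)"
    by (auto intro!: vp.span_sum vp.span_scale intro: vp.span_base rev_image_eqI)
qed

lemma bd_E_bottom:
  fixes v :: "'f::field vpoly"
  assumes "v \<in> E n (j + 0) j"
  shows "bd n v = 0"
proof -
  have "bd n v \<in> vp.span {}"
    using linear_bd assms unfolding E_eq_span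
  proof (rule linear_span_into)
    fix p :: "'f vpoly" assume "p \<in> case_prod bracket ` bracket_index n 0 j"
    then obtain a b where "p = bracket a b" "a \<subseteq> Vdot n" "b \<subseteq> Vdot n" "card a = 0"
      by (auto simp: bracket_index_def)
    moreover from this have "a = {}" "finite b"
      using finite_Vdot finite_subset card_0_eq by metis+
    ultimately show "bd n p \<in> vp.span {}"
      using bracket_empty_span[of b n, where 'f = 'f] by simp
  qed
  then show ?thesis by simp
qed

lemma eps_E_top:
  assumes "v \<in> E n n j" "j \<le> n"
  shows "eps n v = 0"
proof -
  have "eps n v \<in> vp.span {}"
    using linear_eps assms(1)
    unfolding E_eq_span[of n j "n - j", unfolded le_add_diff_inverse[OF assms(2)]]
  proof (rule linear_span_into)
    fix p :: "'a vpoly" assume "p \<in> case_prod bracket ` bracket_index n (n - j) j"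
    then obtain a b where p: "p = bracket a b" and ab: "a \<subseteq> Vdot n" "b \<subseteq> Vdot n" "a \<inter> b = {}"
        "card a = n - j" "card b = j"
      by (auto simp: bracket_index_def)
    then have "card (a \<union> b) = card (Vdot n)"
      using assms(2) finite_Vdot[of n] by (simp add: card_Un_disjoint finite_subset card_Vdot)
    then have "a \<union> b = Vdot n"
      using ab finite_Vdot by (intro card_subset_eq) auto
    then show "eps n p \<in> vp.span {}"
      by (simp add: p eps_bracket[OF ab(1-3)])
  qed
  then show ?thesis by simp
qed

text \<open>Both composites contain the same sum \<open>?S\<close>, in which some \<alpha>' of
  \<open>a\<close> is exchanged for an \<alpha> outside. They differ only in the multiples of the
  original bracket: 2 for each of the N - t outside elements against 2 for each of the t elements of
  \<open>a\<close>, where N = n - j.\<close>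

lemma commutator_bracket:
  assumes ab: "a \<subseteq> Vdot n" "b \<subseteq> Vdot n" "a \<inter> b = {}" "card a = t" "card b = j"
  shows "bd n (eps n (bracket a b :: 'f::field vpoly)) = eps n (bd n (bracket a b)) +
    smul (of_int (2 * (int (n - j) - 2 * int t))) (bracket a b)"
proof -
  let ?C = "Vdot n - (a \<union> b)" and ?p = "bracket a b :: 'f vpoly"
  let ?S = "\<Sum>\<alpha>\<in>?C. \<Sum>\<alpha>'\<in>a. smul 2 (bracket (insert \<alpha> (a - {\<alpha>'})) b) :: 'f vpoly"
  have fin: "finite a" "finite b" "finite ?C"
    using ab finite_Vdot finite_subset by blast+
  have "card (a \<union> b) = t + j"
    using ab fin by (simp add: card_Un_disjoint)
  moreover have "card (a \<union> b) \<le> n"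
    using card_mono[OF finite_Vdot, of "a \<union> b" n] ab by (simp add: card_Vdot)
  ultimately have C: "int (card ?C) = int (n - j) - int t"
    using ab fin by (simp add: card_Diff_subset card_Vdot)
  have "bd n (eps n ?p) = (\<Sum>\<alpha>\<in>?C. bd n (bracket (insert \<alpha> a) b))"
    by (simp only: eps_bracket[OF ab(1-3)] linear_smul_algebra[OF linear_bd])
  also have "\<dots> = (\<Sum>\<alpha>\<in>?C. smul 2 ?p + (\<Sum>\<alpha>'\<in>a. smul 2 (bracket (insert \<alpha> (a - {\<alpha>'})) b)))"
  proof (rule sum.cong)
    fix \<alpha> assume \<alpha>: "\<alpha> \<in> ?C"
    have "bd n (bracket (insert \<alpha> a) b :: 'f vpoly) =
        (\<Sum>\<alpha>'\<in>insert \<alpha> a. smul 2 (bracket (insert \<alpha> a - {\<alpha>'}) b))"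
      using bracket_span_bd[of "insert \<alpha> a" n b] \<alpha> ab fin by auto
    also have "\<dots> = smul 2 ?p + (\<Sum>\<alpha>'\<in>a. smul 2 (bracket (insert \<alpha> (a - {\<alpha>'})) b))"
      using \<alpha> fin by (auto simp: insert_Diff_if intro!: sum.cong)
    finally show "bd n (bracket (insert \<alpha> a) b :: 'f vpoly) = \<dots>" .
  qed simp
  also have "\<dots> = smul (of_nat (card ?C) * 2) ?p + ?S"
    by (simp add: sum.distrib smul_of_nat[symmetric])
  finally have De: "bd n (eps n ?p) = smul (of_nat (card ?C) * 2) ?p + ?S" .
  have "eps n (bd n ?p) = (\<Sum>\<alpha>'\<in>a. smul 2 (eps n (bracket (a - {\<alpha>'}) b)))"
    using bracket_span_bd[OF fin(1) ab(1-3), where 'f = 'f]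
    by (simp add: linear_smul_algebra[OF linear_eps])
  also have "\<dots> = (\<Sum>\<alpha>'\<in>a. smul 2 ?p + (\<Sum>\<alpha>\<in>?C. smul 2 (bracket (insert \<alpha> (a - {\<alpha>'})) b)))"
  proof (rule sum.cong)
    fix \<alpha>' assume \<alpha>': "\<alpha>' \<in> a"
    \<comment> \<open>The removed \<alpha>' becomes available again; putting it back restores the
      original bracket.\<close>
    have C': "Vdot n - (a - {\<alpha>'} \<union> b) = insert \<alpha>' ?C"
      using \<alpha>' ab by auto
    have "eps n (bracket (a - {\<alpha>'}) b :: 'f vpoly) =
        (\<Sum>\<alpha>\<in>insert \<alpha>' ?C. bracket (insert \<alpha> (a - {\<alpha>'})) b)"
      using eps_bracket[of "a - {\<alpha>'}" n b] ab C' by auto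
    also have "\<dots> = ?p + (\<Sum>\<alpha>\<in>?C. bracket (insert \<alpha> (a - {\<alpha>'})) b)"
      using \<alpha>' fin by (simp add: insert_absorb)
    finally show "smul 2 (eps n (bracket (a - {\<alpha>'}) b :: 'f vpoly)) =
        smul 2 ?p + (\<Sum>\<alpha>\<in>?C. smul 2 (bracket (insert \<alpha> (a - {\<alpha>'})) b))"
      by (simp add: vp.scale_right_distrib vp.scale_sum_right)
  qed simp
  also have "\<dots> = smul (of_nat t * 2) ?p + ?S"
    using ab(4) by (simp add: sum.distrib smul_of_nat[symmetric] sum.swap[of _ a])
  finally have eD: "eps n (bd n ?p) = smul (of_nat t * 2) ?p + ?S" .
  have "of_nat (card ?C) * 2 = of_nat t * 2 + (of_int (2 * (int (n - j) - 2 * int t)) :: 'f)"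
  proof -
    have "int (card ?C) * 2 = int t * 2 + 2 * (int (n - j) - 2 * int t)"
      using C by simp
    then have "(of_int (int (card ?C) * 2) :: 'f) = of_int (int t * 2 + 2 * (int (n - j) - 2 * int t))"
      by (rule arg_cong)
    then show ?thesis
      by (simp only: of_int_add of_int_mult of_int_of_nat_eq of_int_numeral)
  qed
  then show ?thesis
    unfolding De eD by (simp only: vp.scale_left_distrib ac_simps)
qed

lemma commutator_E:
  assumes "v \<in> E n (j + t) j"
  shows "bd n (eps n v) = eps n (bd n v) + smul (of_int (2 * (int (n - j) - 2 * int t))) v"
  using assms unfolding E_eq_span
proof (induction rule: vp.span_induct_alt)
  case base
  then show ?case
    by (simp add: linear_smul_algebra[OF linear_eps] linear_smul_algebra[OF linear_bd])
next
  case (step c p q)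
  then obtain a b where "p = bracket a b" "a \<subseteq> Vdot n" "b \<subseteq> Vdot n" "a \<inter> b = {}" "card a = t"
      "card b = j"
    by (auto simp: bracket_index_def)
  then have "bd n (eps n p) = eps n (bd n p) + smul (of_int (2 * (int (n - j) - 2 * int t))) p"
    by (simp only: commutator_bracket)
  then show ?case
    using step(2)
    by (simp only: linear_smul_algebra[OF linear_eps] linear_smul_algebra[OF linear_bd]
        vp.scale_right_distrib vp.scale_left_commute[of c] ac_simps)
qed

text \<open>The hypothesis on the characteristic makes 1, ..., n invertible in the field, and
  \<open>2 \<le> n\<close> places 2 among them.\<close>

lemma raising_lowering_E:
  assumes char: "CHAR('f::field) = 0 \<or> n < CHAR('f)" and "2 \<le> n" "j \<le> n"
  shows "raising_lowering (eps n) (bd n) (\<lambda>t. E n (j + t) j :: 'f vpoly set) (n - j) (n choose j)"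
proof (rule raising_lowering.intro)
  have nonzero: "(of_nat a :: 'f) \<noteq> 0" if "0 < a" "a \<le> n" for a
    using that char by (auto simp: of_nat_eq_0_iff_char_dvd dest: dvd_imp_le)
  show two: "(2 :: 'f) \<noteq> 0"
    using nonzero[of 2] assms(2) by simp
  show "(of_nat a :: 'f) \<noteq> 0" if "0 < a" "a \<le> n - j" for a
    using nonzero that by simp
  show "vp.dim (E n (j + t) j :: 'f vpoly set) = (n choose j) * (n - j choose t)" for t
    by (rule dim_E[OF two])
  show "\<exists>F. finite F \<and> (E n (j + t) j :: 'f vpoly set) \<subseteq> vp.span F" for t
    unfolding E_eq_span using finite_bracket_index by blast
  show "vp.subspace (E n (j + t) j :: 'f vpoly set)" for t
    by (simp add: E_def)
qed (use assms in \<open>auto simp: linear_eps linear_bd eps_E bd_E bd_E_bottom eps_E_top commutator_E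
    simp del: add_Suc_right\<close>)

theorem theorem2p9:
  fixes n k j m :: nat
  assumes char: "CHAR('f::field) = 0 \<or> n < CHAR('f)"
    and n: "2 \<le> n" and k: "k \<le> n" and j: "j \<le> k"
    and m: "m = min (k - j) (n - k)"
  shows
    "(eigenvalues_on (nu_plus n) (E n k j) = {lam n k j i :: 'f | i. i \<le> m}
      \<and> inj_on (\<lambda>i. lam n k j i :: 'f) {0..m}
      \<and> (\<forall>i\<le>m. (lam n k j i :: 'f) = 0 \<longleftrightarrow> i = n - k \<and> n - k \<le> k - j))
    \<and> (semisimple_on (nu_plus n) (E n k j :: 'f vpoly set)
      \<and> (\<forall>i\<le>m. int (vp.dim (Eig n k j i :: 'f vpoly set))
            = d n (int j + int i) j - d n (int j + int i - 1) j))
    \<and> (\<forall>i\<le>n - j.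
        (\<forall>s. j + i \<le> s \<and> s < n - i \<longrightarrow>
          restricts_to_iso (eps n) (Eig n s j i :: 'f vpoly set) (Eig n (s + 1) j i) \<and>
          restricts_to_iso (bd n) (Eig n (s + 1) j i :: 'f vpoly set) (Eig n s j i))
        \<and> bd n ` (Eig n (j + i) j i :: 'f vpoly set) = {0}
        \<and> eps n ` (Eig n (n - i) j i :: 'f vpoly set) = {0})"
proof -
  let ?N = "n - j" and ?t = "k - j"
  have jn: "j \<le> n" using j k by simp
  interpret raising_lowering "eps n" "bd n" "\<lambda>t. E n (j + t) j :: 'f vpoly set" ?N "n choose j"
    by (rule raising_lowering_E[OF char n jn])
  have lam: "lam n s j i = eigval (s - j) i" if "j \<le> s" for s i
    using that jn by (simp add: lam_def eigval_def of_nat_diff algebra_simps)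
  have Eig: "Eig n s j i = eigsp (s - j) i" if "j \<le> s" for s i
    using that by (simp add: Eig_def eigsp_def lam nu_plus_def)
  have t: "?t \<le> ?N" "j + ?t = k" and m': "m = min ?t (?N - ?t)"
    using j k m by auto
  have "eigenvalues_on (nu_plus n) (E n k j) = {lam n k j i :: 'f | i. i \<le> m}"
    using eigenvalues_De[OF t(1)] by (simp only: t m' nu_plus_def lam[OF j])
  moreover have "inj_on (\<lambda>i. lam n k j i :: 'f) {0..m}"
    using inj_on_eigval[OF t(1)]
    by (simp only: lam[OF j] m' lessThan_Suc_atMost atLeast0AtMost)
  moreover have "(lam n k j i :: 'f) = 0 \<longleftrightarrow> i = n - k \<and> n - k \<le> k - j" if "i \<le> m" for i
    using eigval_eq_0_iff[OF t(1), of i] that j k by (auto simp: lam[OF j] m)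
  moreover have "semisimple_on (nu_plus n) (E n k j :: 'f vpoly set)"
    using semisimple_De[OF t(1)] by (simp only: t nu_plus_def)
  moreover have "int (vp.dim (Eig n k j i :: 'f vpoly set))
            = d n (int j + int i) j - d n (int j + int i - 1) j" if "i \<le> m" for i
  proof -
    \<comment> \<open>Choosing j + r elements and then j among them is the same as choosing the j
      elements first and then r of the remaining n - j.\<close>
    have d_choose: "d n (int j + int r) j = int (n choose j) * int (n - j choose r)"
      if "r \<le> i" for r
    proof -
      have "j + r \<le> n" using that \<open>i \<le> m\<close> jn t m' by linarith
      then have "(n choose (j + r)) * ((j + r) choose j) = (n choose j) * (n - j choose r)"
        using choose_mult[of j "j + r" n] by simp
      moreover have "nat (int j + int r) = j + r"
        by simp
      ultimately show ?thesis
        using \<open>j + r \<le> n\<close> by (simp add: d_def flip: of_nat_mult)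
    qed
    \<comment> \<open>For \<open>i = 0\<close> the first index is below \<open>j\<close>, so
      \<open>d\<close> takes its default value 0, in agreement with the case distinction in
      \<open>dim_eigsp\<close>.\<close>
    have "d n (int j + int i - 1) j =
        (if i = 0 then 0 else int (n choose j) * int (n - j choose (i - 1)))"
    proof (cases i)
      case 0
      then show ?thesis by (simp add: d_def)
    next
      case (Suc r)
      then show ?thesis using d_choose[of r] by simp
    qed
    then show ?thesis
      using dim_eigsp[of i ?t] that t m' d_choose[of i] by (simp add: Eig[OF j] right_diff_distrib)
  qed
  moreover have "restricts_to_iso (eps n) (Eig n s j i :: 'f vpoly set) (Eig n (s + 1) j i) \<and>
      restricts_to_iso (bd n) (Eig n (s + 1) j i :: 'f vpoly set) (Eig n s j i)"
    if "j + i \<le> s" "s < n - i" for i s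
  proof -
    have "j \<le> s" "Suc s - j = Suc (s - j)"
      using that by auto
    then show ?thesis
      using iso_eigsp[of i "s - j"] that by (simp add: Eig)
  qed
  moreover have "bd n ` (Eig n (j + i) j i :: 'f vpoly set) = {0}" if "i \<le> n - j" for i
    using D_eigsp_bottom[OF that] by (simp add: Eig)
  moreover have "eps n ` (Eig n (n - i) j i :: 'f vpoly set) = {0}" if "i \<le> n - j" for i
    using e_eigsp_top[OF that] that jn by (simp add: Eig add.commute)
  ultimately show ?thesis
    by blast
qed

end
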